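(* Let $G$ be a graph, let $G_\ell$ be the graph obtained from $G$ by replacing each edge by a path with $\ell$ edges, and let $\mathcal{O}_\ell$ be the $\ell$-vertex cycle. For $\ell>1$, \[\epsilon(G_{\ell}) \le \frac{\epsilon(\mathcal{O}_{\ell})\,\epsilon^{-}(G)}{\epsilon(\mathcal{O}_{\ell}) + 2\epsilon^{-}(G)}.\]
   Context: All graphs are finite, undirected, without multiple edges, and by convention every loop $\{i,i\}$ is an edge (only non-loop edges are replaced in forming $G_\ell$). A clique is a set of pairwise adjacent vertices (singletons included). Lengthening: for each non-loop edge $e=\{u,v\}$ of $G$, introduce vertices $x_{e,1},\dots,x_{e,\ell+1}$ with $x_{e,1}=u$ and $x_{e,\ell+1}=v$ (the $x_{e,i}$ with $2\le i\le \ell$ being new vertices); $G_\ell$ has vertex set $V(G)$ together with all the new vertices, and its non-loop edges are the $\{x_{e,i},x_{e,i+1}\}$ for $1\le i\le\ell$ and all such $e$. In particular $G_1=G$. For a graph $K$, a $K$-partial matrix is a symmetric real array $X$ with entries $X_{ij}=X_{ji}$ specified exactly for $\{i,j\}\in E(K)$ (including all diagonal entries); the vector space of these is $\mathrm{Sym}(K)$. $\mathcal{S}(K)\subseteq \mathrm{Sym}(K)$ is the cone of PSD-completable partial matrices, i.e. those whose unspecified entries can be chosen to give a positive semidefinite (PSD) matrix. $\mathcal{P}(K)$ is the cone of $X\in\mathrm{Sym}(K)$ such that for every clique $C$ of $K$ the submatrix $X|_C$ is PSD, and $\mathcal{P}^-(K)$ is the set of $X\in\mathrm{Sym}(K)$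 such that $X|_{\{i,j\}}$ is PSD for every $\{i,j\}\in E(K)$ (loops included). Let $\mathrm{tr}(X)=\sum_i X_{ii}$ and let $I_K$ be the projection of the identity matrix to $\mathrm{Sym}(K)$. Define $\epsilon_K(X)=\min\{\epsilon : X+\epsilon I_K\in\mathcal{S}(K)\}$, $\epsilon(K)=\max\{\epsilon_K(X):X\in\mathcal{P}(K),\ \mathrm{tr}(X)=1\}$ and $\epsilon^-(K)=\max\{\epsilon_K(X):X\in\mathcal{P}^-(K),\ \mathrm{tr}(X)=1\}$.
   Formalization: G is nonempty. For ℓ=3, ε(O_3) is replaced by ε^-(O_3), since the triangle is a clique, ε(O_3)=0, and the bound fails for G=K_3; for ℓ=2, where no simple 2-cycle exists, the bound is read as ε(G_2) ≤ ε^-(G), the limit as ε(O_2)→∞. *)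

theory Defs
  imports Complex_Main
begin

text \<open>
  A graph is a finite vertex set together with a set of two-element subsets of it, the non-loop
  edges.  The loops \<open>{i}\<close>, all of which are edges by convention, are not stored; they are put
  back by \<open>adj\<close>.
\<close>

record 'a ugraph =
  verts :: "'a set"
  edges :: "'a set set"

definition is_graph :: "'a ugraph \<Rightarrow> bool" where
  "is_graph K \<longleftrightarrow> finite (verts K) \<and> (\<forall>e\<in>edges K. e \<subseteq> verts K \<and> card e = 2)"

definition adj :: "'a ugraph \<Rightarrow> 'a \<Rightarrow> 'a \<Rightarrow> bool" where
  "adj K i j \<longleftrightarrow> i \<in> verts K \<and> j \<in> verts K \<and> (i = j \<or> {i, j} \<in> edges K)"

definition clique :: "'a ugraph \<Rightarrow> 'a set \<Rightarrow> bool" where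
  "clique K C \<longleftrightarrow> C \<subseteq> verts K \<and> (\<forall>i\<in>C. \<forall>j\<in>C. adj K i j)"

text \<open>The cycle on the vertices \<open>0, \<dots>, n - 1\<close>; meaningful for \<open>n \<ge> 3\<close>.
  For \<open>n = 3\<close> the whole cycle is a clique, so \<open>eps (cycle_graph 3) = 0\<close>, whereas \<open>eps_minus\<close>
  follows the pattern \<open>(1 / cos (pi / n) - 1) / n\<close> of the longer cycles, for which \<open>eps\<close> and
  \<open>eps_minus\<close> agree.\<close>

definition cycle_graph :: "nat \<Rightarrow> nat ugraph" where
  "cycle_graph n = \<lparr>verts = {..<n}, edges = {{i, Suc i mod n} | i. i < n}\<rparr>"

text \<open>
  The path replacing an edge \<open>e = {u, v}\<close> has to be traversed in one of its two directions.
  The direction is an arbitrary choice; different choices give isomorphic graphs.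
\<close>

definition edge_src :: "'a set \<Rightarrow> 'a" where
  "edge_src e = (SOME u. u \<in> e)"

definition edge_tgt :: "'a set \<Rightarrow> 'a" where
  "edge_tgt e = (SOME v. v \<in> e - {edge_src e})"

datatype 'a lvertex = Orig 'a | New "'a set" nat

definition path_vertex :: "nat \<Rightarrow> 'a set \<Rightarrow> nat \<Rightarrow> 'a lvertex" where
  "path_vertex l e i =
     (if i = 1 then Orig (edge_src e)
      else if i = l + 1 then Orig (edge_tgt e)
      else New e i)"

definition lengthen :: "nat \<Rightarrow> 'a ugraph \<Rightarrow> 'a lvertex ugraph" where
  "lengthen l G =
     \<lparr>verts = Orig ` verts G \<union> {New e i | e i. e \<in> edges G \<and> 2 \<le> i \<and> i \<le> l},
      edges = {{path_vertex l e i, path_vertex l e (i + 1)} | e i.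
                 e \<in> edges G \<and> 1 \<le> i \<and> i \<le> l}\<rparr>"

text \<open>
  A matrix indexed by a finite set \<open>C\<close> is a function of two arguments, only the values on
  \<open>C \<times> C\<close> being relevant; \<open>psd_on C M\<close> therefore speaks about the principal submatrix of \<open>M\<close>
  on \<open>C\<close>.
\<close>

definition psd_on :: "'a set \<Rightarrow> ('a \<Rightarrow> 'a \<Rightarrow> real) \<Rightarrow> bool" where
  "psd_on C M \<longleftrightarrow>
     (\<forall>i\<in>C. \<forall>j\<in>C. M i j = M j i) \<and>
     (\<forall>x :: 'a \<Rightarrow> real. 0 \<le> (\<Sum>i\<in>C. \<Sum>j\<in>C. x i * M i j * x j))"

text \<open>
  The unspecified positions of a partial matrix carry the placeholder value 0, so that every
  partial matrix has exactly one representative.  The placeholder is never treated as an entry: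
  \<open>psd_completable\<close> leaves these positions free, and the submatrices considered in \<open>clique_psd\<close>
  and \<open>edge_psd\<close> contain no such positions.
\<close>

definition partial_mats :: "'a ugraph \<Rightarrow> ('a \<Rightarrow> 'a \<Rightarrow> real) set" where
  "partial_mats K = {X. (\<forall>i j. X i j = X j i) \<and> (\<forall>i j. \<not> adj K i j \<longrightarrow> X i j = 0)}"

definition psd_completable :: "'a ugraph \<Rightarrow> ('a \<Rightarrow> 'a \<Rightarrow> real) set" where
  "psd_completable K =
     {X \<in> partial_mats K. \<exists>M. psd_on (verts K) M \<and> (\<forall>i j. adj K i j \<longrightarrow> M i j = X i j)}"

definition clique_psd :: "'a ugraph \<Rightarrow> ('a \<Rightarrow> 'a \<Rightarrow> real) set" where
  "clique_psd K = {X \<in> partial_mats K. \<forall>C. clique K C \<longrightarrow> psd_on C X}"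

definition edge_psd :: "'a ugraph \<Rightarrow> ('a \<Rightarrow> 'a \<Rightarrow> real) set" where
  "edge_psd K = {X \<in> partial_mats K. \<forall>i j. adj K i j \<longrightarrow> psd_on {i, j} X}"

definition ptrace :: "'a ugraph \<Rightarrow> ('a \<Rightarrow> 'a \<Rightarrow> real) \<Rightarrow> real" where
  "ptrace K X = (\<Sum>i\<in>verts K. X i i)"

definition id_partial :: "'a ugraph \<Rightarrow> 'a \<Rightarrow> 'a \<Rightarrow> real" where
  "id_partial K i j = (if i \<in> verts K \<and> i = j then 1 else 0)"

text \<open>
  For a graph with at least one vertex, the infimum and the suprema below are attained: the sets
  of admissible \<open>\<epsilon>\<close> are closed, nonempty and bounded below, and the sets of partial matrices of
  trace 1 are compact and nonempty.
\<close>

definition eps_at :: "'a ugraph \<Rightarrow> ('a \<Rightarrow> 'a \<Rightarrow> real) \<Rightarrow> real" where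
  "eps_at K X = Inf {\<epsilon>. (\<lambda>i j. X i j + \<epsilon> * id_partial K i j) \<in> psd_completable K}"

definition eps :: "'a ugraph \<Rightarrow> real" where
  "eps K = Sup {eps_at K X | X. X \<in> clique_psd K \<and> ptrace K X = 1}"

definition eps_minus :: "'a ugraph \<Rightarrow> real" where
  "eps_minus K = Sup {eps_at K X | X. X \<in> edge_psd K \<and> ptrace K X = 1}"

end

theory Submission
  imports Defs
begin

text \<open>
  Let \<open>X\<close> have trace 1 and let \<open>t\<^sub>0\<close> be the part of the trace on the original vertices, \<open>t e\<close> the
  part on the interior of the path replacing \<open>e\<close>.  A completion of \<open>X + \<epsilon> I\<close> on \<open>lengthen l G\<close>
  amounts to a choice of one closing value per edge of \<open>G\<close> which admits a completion on \<open>G\<close> and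
  on every path.  Let \<open>c\<close> be the value of the \<open>l\<close>-cycle.  If \<open>c * t e \<le> \<epsilon>\<close>, the path can be
  completed with orthogonal end vectors, so \<open>0\<close> is an admissible closing value; for the remaining
  edges the closing value is taken from a completion of \<open>X\<close> on the path.  If at most one edge
  remains, the closed matrix on \<open>G\<close> is positive semidefinite already.  If at least two remain, then
  \<open>t\<^sub>0 \<le> 1 - 2 * \<epsilon> / c\<close>, hence \<open>eps_minus G * t\<^sub>0 < \<epsilon>\<close> for every \<open>\<epsilon>\<close> above the claimed bound.
\<close>

section \<open>Positive semidefinite matrices\<close>

text \<open>The value of \<open>eps\<close> on a cycle is never computed. The path argument uses the
  explicit constant \<open>(1 / cos (pi / l) - 1) / l\<close>, and all that is needed is that the
  cycle value is at least this large, which one test matrix, the frustrated cycle, shows. Orthogonal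
  ends come from angles. After the shift, neighbouring path vectors may enclose an angle
  \<open>\<theta> k\<close> and still realise the prescribed entries; once these angles total at
  least a right angle, the path can turn from one end to an orthogonal one. The estimate of the
  total may involve only interior diagonal entries, because the end vertices are shared between
  paths and their trace is charged to \<open>G\<close>. For two or more vertices every tested shift
  exceeds a nonnegative bound and is therefore positive. So no infimum has to be attained, and the
  two end vectors of each path become linearly independent, which lets the gluing avoid degenerate
  projections. The claimed bound is the \<epsilon> with
  \<open>eps_minus G * (1 - 2 * \<epsilon> / c) = \<epsilon>\<close>.\<close>

lemma psd_on_sym: "psd_on C M \<Longrightarrow> i \<in> C \<Longrightarrow> j \<in> C \<Longrightarrow> M i j = M j i"
  by (auto simp: psd_on_def)

lemma psd_on_form: "psd_on C M \<Longrightarrow> 0 \<le> (\<Sum>i\<in>C. \<Sum>j\<in>C. x i * M i j * x j)"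
  by (auto simp: psd_on_def)

lemma psd_on_cong:
  assumes "psd_on C M" "\<And>i j. i \<in> C \<Longrightarrow> j \<in> C \<Longrightarrow> M' i j = M i j"
  shows "psd_on C M'"
  using assms by (simp add: psd_on_def)

lemma psd_on_add:
  assumes "psd_on C A" "psd_on C B"
  shows "psd_on C (\<lambda>i j. A i j + B i j)"
proof -
  have "(\<Sum>i\<in>C. \<Sum>j\<in>C. x i * (A i j + B i j) * x j)
      = (\<Sum>i\<in>C. \<Sum>j\<in>C. x i * A i j * x j) + (\<Sum>i\<in>C. \<Sum>j\<in>C. x i * B i j * x j)" for x
    by (simp add: algebra_simps sum.distrib)
  with assms show ?thesis by (auto simp: psd_on_def)
qed

lemma psd_on_zero: "psd_on C (\<lambda>_ _. 0)"
  by (simp add: psd_on_def)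

lemma psd_on_sum:
  assumes "\<And>e. e \<in> E \<Longrightarrow> psd_on C (A e)"
  shows "psd_on C (\<lambda>i j. \<Sum>e\<in>E. A e i j)"
  using assms by (induction E rule: infinite_finite_induct) (auto intro: psd_on_zero psd_on_add)

lemma psd_on_diag:
  assumes "finite C" "\<And>i. i \<in> C \<Longrightarrow> d i \<ge> 0"
  shows "psd_on C (\<lambda>i j. if i = j then d i else 0)"
proof -
  have "(\<Sum>i\<in>C. \<Sum>j\<in>C. x i * (if i = j then d i else 0) * x j) = (\<Sum>i\<in>C. d i * (x i)\<^sup>2)" for x
  proof (intro sum.cong refl)
    fix i assume "i \<in> C"
    have "(\<Sum>j\<in>C. x i * (if i = j then d i else 0) * x j) = (\<Sum>j\<in>C. if i = j then d i * (x i)\<^sup>2 else 0)"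
      by (intro sum.cong refl) (simp add: power2_eq_square)
    then show "(\<Sum>j\<in>C. x i * (if i = j then d i else 0) * x j) = d i * (x i)\<^sup>2"
      using assms(1) \<open>i \<in> C\<close> by simp
  qed
  then show ?thesis using assms by (auto simp: psd_on_def intro!: sum_nonneg)
qed

text \<open>The form at \<open>x\<close> is the form of \<open>B\<close> at \<open>y\<close>, the
  image of \<open>x\<close> under the transpose of \<open>L\<close>.\<close>

lemma psd_on_congruence:
  assumes "psd_on W B"
  shows "psd_on V (\<lambda>i j. \<Sum>a\<in>W. \<Sum>b\<in>W. L i a * B a b * L j b)"
  unfolding psd_on_def
proof (intro conjI ballI allI)
  fix i j
  have "(\<Sum>a\<in>W. \<Sum>b\<in>W. L i a * B a b * L j b) = (\<Sum>a\<in>W. \<Sum>b\<in>W. L j b * B b a * L i a)"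
    using psd_on_sym[OF assms] by (intro sum.cong refl) simp
  then show "(\<Sum>a\<in>W. \<Sum>b\<in>W. L i a * B a b * L j b) = (\<Sum>a\<in>W. \<Sum>b\<in>W. L j a * B a b * L i b)"
    by (subst (2) sum.swap)
next
  fix x
  define y where "y a = (\<Sum>i\<in>V. x i * L i a)" for a
  have "(\<Sum>i\<in>V. \<Sum>j\<in>V. x i * (\<Sum>a\<in>W. \<Sum>b\<in>W. L i a * B a b * L j b) * x j)
      = (\<Sum>(i,j)\<in>V\<times>V. \<Sum>(a,b)\<in>W\<times>W. x i * L i a * B a b * (x j * L j b))"
    by (simp add: sum_distrib_left sum_distrib_right sum.cartesian_product[symmetric] mult_ac)
  also have "\<dots> = (\<Sum>(a,b)\<in>W\<times>W. \<Sum>(i,j)\<in>V\<times>V. x i * L i a * B a b * (x j * L j b))"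
    by (simp add: case_prod_beta) (rule sum.swap)
  also have "\<dots> = (\<Sum>a\<in>W. \<Sum>b\<in>W. y a * B a b * y b)"
    by (simp add: sum.cartesian_product[symmetric] y_def sum_distrib_left sum_distrib_right mult_ac)
  finally show "0 \<le> (\<Sum>i\<in>V. \<Sum>j\<in>V. x i * (\<Sum>a\<in>W. \<Sum>b\<in>W. L i a * B a b * L j b) * x j)"
    using psd_on_form[OF assms] by simp
qed

text \<open>Congruence with a matrix having at most one nonzero entry per row. It covers
  restricting, rescaling, duplicating an index and padding by zeros; where \<open>w\<close>
  vanishes, \<open>f\<close> may leave \<open>W\<close>.\<close>

lemma psd_on_pullback:
  assumes "psd_on W B" "finite W" "\<And>i. i \<in> V \<Longrightarrow> w i \<noteq> 0 \<Longrightarrow> f i \<in> W"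
  shows "psd_on V (\<lambda>i j. w i * B (f i) (f j) * w j)"
proof -
  have "(\<Sum>a\<in>W. \<Sum>b\<in>W. (if a = f i then w i else 0) * B a b * (if b = f j then w j else 0))
      = w i * B (f i) (f j) * w j" (is "?l = _") if "i \<in> V" "j \<in> V" for i j
  proof -
    have "?l = (\<Sum>a\<in>W. if a = f i then \<Sum>b\<in>W. if b = f j then w i * B a b * w j else 0 else 0)"
      by (intro sum.cong refl) (auto intro!: sum.cong)
    then show ?thesis
      using assms(2) assms(3)[OF that(1)] assms(3)[OF that(2)] by auto
  qed
  with psd_on_congruence[OF assms(1), of V "\<lambda>i a. if a = f i then w i else 0"]
  show ?thesis by (auto elim!: psd_on_cong)
qed

lemma psd_on_subset:
  assumes "psd_on W B" "finite W" "V \<subseteq> W"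
  shows "psd_on V B"
  using psd_on_pullback[OF assms(1,2), of V "\<lambda>_. 1" id] assms(3) by auto

lemma psd_on_diag_nonneg:
  assumes "psd_on C M" "finite C" "i \<in> C"
  shows "0 \<le> M i i"
proof -
  have "psd_on {i} M" using assms psd_on_subset by (metis empty_subsetI insert_subset)
  then show ?thesis using psd_on_form[of "{i}" M "\<lambda>_. 1"] by simp
qed

lemma psd_on_pair_form:
  assumes "psd_on {i, j} M" "i \<noteq> j"
  shows "0 \<le> M i i * s\<^sup>2 + 2 * M i j * s * t + M j j * t\<^sup>2"
  using psd_on_form[OF assms(1), of "\<lambda>k. if k = i then s else t"] assms(2)
    psd_on_sym[OF assms(1), of i j]
  by (simp add: algebra_simps power2_eq_square)

lemma psd_on_pair_det:
  assumes "psd_on {i, j} M" "i \<noteq> j"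
  shows "(M i j)\<^sup>2 \<le> M i i * M j j"
proof (cases "M j j = 0")
  case False
  then have pos: "M j j > 0" using psd_on_diag_nonneg[OF assms(1), of j] by simp
  \<comment> \<open>Up to scaling, this test vector minimises the form for a fixed first
    coordinate.\<close>
  have "0 \<le> M j j * (M i i * M j j - (M i j)\<^sup>2)"
    using psd_on_pair_form[OF assms, of "M j j" "- M i j"]
    by (simp add: algebra_simps power2_eq_square)
  then show ?thesis using pos by (simp add: zero_le_mult_iff)
next
  case True
  have "M i j = 0"
  proof (rule ccontr)
    assume nz: "M i j \<noteq> 0"
    \<comment> \<open>With \<open>M j j = 0\<close> the form is affine in \<open>t\<close>; this
      \<open>t\<close> makes it equal to -1.\<close>
    have "0 \<le> M i i + 2 * M i j * (- (M i i + 1) / (2 * M i j))"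
      using psd_on_pair_form[OF assms, of 1 "- (M i i + 1) / (2 * M i j)"] True by simp
    also have "\<dots> = -1" using nz by (simp add: field_simps)
    finally show False by simp
  qed
  then show ?thesis using True by simp
qed

lemma psd_on_pairI:
  assumes "i \<noteq> j" "M i j = M j i" "0 \<le> M i i" "0 \<le> M j j" "(M i j)\<^sup>2 \<le> M i i * M j j"
  shows "psd_on {i, j} M"
proof -
  have "0 \<le> M i i * s\<^sup>2 + 2 * M i j * s * t + M j j * t\<^sup>2" for s t
  proof -
    have "\<bar>M i j * s * t\<bar> \<le> sqrt (M i i) * \<bar>s\<bar> * (sqrt (M j j) * \<bar>t\<bar>)"
    proof -
      have "\<bar>M i j\<bar> \<le> sqrt (M i i) * sqrt (M j j)"
        using assms(5) by (metis real_le_rsqrt real_sqrt_mult power2_abs)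
      then have "\<bar>M i j\<bar> * (\<bar>s\<bar> * \<bar>t\<bar>) \<le> sqrt (M i i) * sqrt (M j j) * (\<bar>s\<bar> * \<bar>t\<bar>)"
        by (intro mult_right_mono) auto
      then show ?thesis by (simp add: abs_mult mult_ac)
    qed
    moreover have "2 * (sqrt (M i i) * \<bar>s\<bar> * (sqrt (M j j) * \<bar>t\<bar>)) \<le> M i i * s\<^sup>2 + M j j * t\<^sup>2"
      using sum_squares_bound[of "sqrt (M i i) * \<bar>s\<bar>" "sqrt (M j j) * \<bar>t\<bar>"] assms(3,4)
      by (simp add: power_mult_distrib mult_ac)
    ultimately show ?thesis by linarith
  qed
  from this[of "x i" "x j" for x] assms(1,2) show ?thesis
    unfolding psd_on_def by (auto simp: algebra_simps power2_eq_square)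
qed

lemma psd_on_triple_form:
  assumes "psd_on {i, j, k} M" "i \<noteq> j" "i \<noteq> k" "j \<noteq> k"
  shows "0 \<le> M i i * s\<^sup>2 + M j j * t\<^sup>2 + M k k * u\<^sup>2
    + 2 * (M i j * s * t + M i k * s * u + M j k * t * u)"
  using psd_on_form[OF assms(1), of "\<lambda>m. if m = i then s else if m = j then t else u"] assms(2-4)
    psd_on_sym[OF assms(1), of i j] psd_on_sym[OF assms(1), of i k] psd_on_sym[OF assms(1), of j k]
  by (simp add: algebra_simps power2_eq_square)

lemma psd_on_scale:
  assumes "psd_on C M" "0 \<le> c"
  shows "psd_on C (\<lambda>i j. c * M i j)"
proof -
  have "(\<Sum>i\<in>C. \<Sum>j\<in>C. x i * (c * M i j) * x j) = c * (\<Sum>i\<in>C. \<Sum>j\<in>C. x i * M i j * x j)" for x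
    by (simp add: sum_distrib_left mult_ac)
  with assms show ?thesis by (auto simp: psd_on_def)
qed

lemma psd_on_singletonI: "0 \<le> M v v \<Longrightarrow> psd_on {v} M"
  using psd_on_diag[of "{v}" "\<lambda>v. M v v"] by (auto elim: psd_on_cong)

text \<open>\<open>Y\<close> is its block on \<open>T\<close> plus a nonnegative diagonal matrix off
  \<open>T\<close>. With \<open>T\<close> a single edge, this is why one exceptional edge costs no
  shift.\<close>

lemma psd_on_single_edge:
  assumes "finite V" "\<And>v. v \<in> V \<Longrightarrow> 0 \<le> Y v v" "psd_on T Y" "T \<subseteq> V"
    and "\<And>u v. u \<noteq> v \<Longrightarrow> \<not> {u, v} \<subseteq> T \<Longrightarrow> Y u v = 0"
  shows "psd_on V Y"
proof -
  define w where "w v = (if v \<in> T then 1 else (0::real))" for v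
  have "psd_on V (\<lambda>u v. w u * Y u v * w v + (if u = v then if u \<in> T then 0 else Y u u else 0))"
    using assms finite_subset[OF assms(4,1)]
    by (intro psd_on_add psd_on_pullback[where f = "\<lambda>v. v" and W = T] psd_on_diag)
      (auto simp: w_def split: if_splits)
  then show ?thesis
  proof (rule psd_on_cong)
    fix u v
    show "Y u v = w u * Y u v * w v + (if u = v then if u \<in> T then 0 else Y u u else 0)"
      using assms(5)[of u v] by (auto simp: w_def)
  qed
qed

text \<open>In Gram terms, vector \<open>i\<close> is \<open>p i\<close> times vector
  \<open>s\<close> plus \<open>q i\<close> times vector \<open>t\<close> plus a remainder orthogonal
  to both, and \<open>R\<close> is the Gram matrix of the remainders. The determinant condition
  makes the two base vectors independent.\<close>

lemma psd_on_schur_complement: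
  assumes P: "psd_on S P" and S: "finite S" "s \<in> S" "t \<in> S" "s \<noteq> t"
    and D: "P s s * P t t \<noteq> (P s t)\<^sup>2"
  obtains p q R where "psd_on S R" "p s = 1" "q s = 0" "p t = 0" "q t = 1"
    "\<And>j. j \<in> S \<Longrightarrow> R s j = 0" "\<And>j. j \<in> S \<Longrightarrow> R t j = 0"
    "\<And>i j. i \<in> S \<Longrightarrow> j \<in> S \<Longrightarrow>
      P i j = p i * p j * P s s + (p i * q j + q i * p j) * P s t + q i * q j * P t t + R i j"
proof -
  define d where "d = P s s * P t t - (P s t)\<^sup>2"
  have d: "d \<noteq> 0" using D by (simp add: d_def)
  have sym: "P t s = P s t" using psd_on_sym[OF P] S by auto
  \<comment> \<open>Cramer's rule for the two orthogonality equations stated next.\<close>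
  define p where "p i = (P s i * P t t - P t i * P s t) / d" for i
  define q where "q i = (P t i * P s s - P s i * P s t) / d" for i
  have Ps: "P s i = p i * P s s + q i * P s t" and Pt: "P t i = p i * P s t + q i * P t t" for i
  proof -
    have "d * (p i * P s s + q i * P s t) = d * P s i" "d * (p i * P s t + q i * P t t) = d * P t i"
      using d by (simp_all add: p_def q_def distrib_left flip: mult.assoc)
        (simp_all add: d_def algebra_simps power2_eq_square)
    then show "P s i = p i * P s s + q i * P s t" "P t i = p i * P s t + q i * P t t"
      using d by simp_all
  qed
  define R where "R i j = P i j
    - (p i * p j * P s s + (p i * q j + q i * p j) * P s t + q i * q j * P t t)" for i j
  \<comment> \<open>Row \<open>i\<close> subtracts the projection, so that \<open>R\<close> is the
    congruence of \<open>P\<close> by \<open>L\<close>.\<close>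
  define L where "L i a = (if a = i then 1 else 0) - (if a = s then p i else 0) - (if a = t then q i else (0::real))" for i a
  have L: "(\<Sum>a\<in>S. L i a * f a) = f i - p i * f s - q i * f t" if "i \<in> S" for i f
  proof -
    have "(\<Sum>a\<in>S. L i a * f a) = (\<Sum>a\<in>S. (if a = i then f a else 0) - (if a = s then p i * f a else 0)
        - (if a = t then q i * f a else 0))"
      by (intro sum.cong refl) (simp add: L_def algebra_simps)
    then show ?thesis using S that by (simp add: sum_subtractf)
  qed
  have "(\<Sum>a\<in>S. \<Sum>b\<in>S. L i a * P a b * L j b) = R i j" if "i \<in> S" "j \<in> S" for i j
  proof -
    have "(\<Sum>a\<in>S. \<Sum>b\<in>S. L i a * P a b * L j b) = (\<Sum>a\<in>S. L i a * (\<Sum>b\<in>S. L j b * P a b))"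
      by (simp add: sum_distrib_left mult_ac)
    also have "\<dots> = (P i j - p j * P i s - q j * P i t) - p i * (P s j - p j * P s s - q j * P s t)
        - q i * (P t j - p j * P t s - q j * P t t)"
      using that by (simp add: L)
    also have "\<dots> = R i j"
      using psd_on_sym[OF P, of i s] psd_on_sym[OF P, of i t] S that
      by (simp add: R_def sym Ps[of i] Ps[of j] Pt[of i] Pt[of j] algebra_simps)
    finally show ?thesis .
  qed
  with psd_on_congruence[OF P, of S L] have psd: "psd_on S R" by (auto elim!: psd_on_cong)
  have pq: "p s = 1" "q s = 0" "p t = 0" "q t = 1"
    using d sym by (simp_all add: p_def q_def d_def power2_eq_square mult_ac)
  have R0: "R s j = 0" "R t j = 0" for j
    unfolding R_def pq Ps[of j] Pt[of j] by simp_all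
  have "P i j = p i * p j * P s s + (p i * q j + q i * p j) * P s t + q i * q j * P t t + R i j" for i j
    unfolding R_def by simp
  from that[OF psd pq R0 this] show ?thesis .
qed

section \<open>Completion of paths\<close>

text \<open>The Gaussian Markov chain with consecutive correlations \<open>r\<close>.\<close>

lemma psd_on_path_correlation:
  fixes r :: "nat \<Rightarrow> real"
  assumes "\<And>k. k < n \<Longrightarrow> \<bar>r k\<bar> \<le> 1"
  shows "\<exists>N. psd_on {..n} N \<and> (\<forall>k\<le>n. N k k = 1) \<and> (\<forall>k<n. N k (Suc k) = r k)"
  using assms
proof (induction n)
  case 0
  have "psd_on {..0::nat} (\<lambda>_ _. 1)" by (simp add: psd_on_def)
  then show ?case by auto
next
  case (Suc n)
  then obtain N where N: "psd_on {..n} N" "\<And>k. k \<le> n \<Longrightarrow> N k k = 1" "\<And>k. k < n \<Longrightarrow> N k (Suc k) = r k"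
    by (metis less_Suc_eq)
  \<comment> \<open>The new vertex is \<open>r n\<close> times a copy of vertex \<open>n\<close>
    (the \<open>min\<close> below redirects its index) plus independent noise of variance
    \<open>1 - (r n)\<^sup>2\<close>.\<close>
  define w where "w k = (if k = Suc n then r n else 1)" for k
  define d where "d k = (if k = Suc n then 1 - (r n)\<^sup>2 else 0)" for k
  define N' where "N' i j = w i * N (min i n) (min j n) * w j + (if i = j then d i else 0)" for i j
  have "(r n)\<^sup>2 \<le> 1" using Suc.prems[of n] by (simp add: abs_square_le_1)
  then have "psd_on {..Suc n} N'" unfolding N'_def
    by (intro psd_on_add psd_on_pullback[OF N(1)] psd_on_diag) (auto simp: d_def)
  moreover have "N' k k = 1" if "k \<le> Suc n" for k
    using that N(2)[of k] N(2)[of n] by (auto simp: N'_def w_def d_def min_def power2_eq_square)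
  moreover have "N' k (Suc k) = r k" if "k < Suc n" for k
    using that N(2)[of n] N(3)[of k] by (auto simp: N'_def w_def d_def min_def not_le less_Suc_eq)
  ultimately show ?case by blast
qed

lemma psd_path_completion:
  fixes a b :: "nat \<Rightarrow> real"
  assumes a: "\<And>k. k \<le> n \<Longrightarrow> 0 \<le> a k"
    and b: "\<And>k. k < n \<Longrightarrow> (b k)\<^sup>2 \<le> a k * a (Suc k)"
  obtains P where "psd_on {..n} P" "\<And>k. k \<le> n \<Longrightarrow> P k k = a k" "\<And>k. k < n \<Longrightarrow> P k (Suc k) = b k"
proof -
  \<comment> \<open>If the denominator vanishes, so does \<open>b k\<close>, and the default
    quotient 0 is the right value.\<close>
  define r where "r k = b k / (sqrt (a k) * sqrt (a (Suc k)))" for k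
  have ab: "\<bar>b k\<bar> \<le> sqrt (a k) * sqrt (a (Suc k))" if "k < n" for k
    using b[OF that] by (metis real_le_rsqrt real_sqrt_mult power2_abs)
  have "\<bar>r k\<bar> \<le> 1" if "k < n" for k
    using ab[OF that] a[of k] a[of "Suc k"] that
    by (cases "sqrt (a k) * sqrt (a (Suc k)) = 0")
      (auto simp: r_def abs_mult divide_le_eq_1)
  from psd_on_path_correlation[of n r, OF this]
  obtain N where N: "psd_on {..n} N" "\<And>k. k \<le> n \<Longrightarrow> N k k = 1" "\<And>k. k < n \<Longrightarrow> N k (Suc k) = r k"
    by blast
  define P where "P i j = sqrt (a i) * N i j * sqrt (a j)" for i j
  have "psd_on {..n} P" using psd_on_pullback[OF N(1), of "{..n}" "\<lambda>i. sqrt (a i)" "\<lambda>i. i"]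
    by (simp add: P_def[abs_def])
  moreover have "P k k = a k" if "k \<le> n" for k using that N(2) a by (simp add: P_def)
  moreover have "P k (Suc k) = b k" if "k < n" for k
    using that N(3) ab[OF that] by (cases "sqrt (a k) * sqrt (a (Suc k)) = 0") (auto simp: P_def r_def)
  ultimately show ?thesis using that by blast
qed

section \<open>Trigonometric estimate of the total angle along a path\<close>

lemma sin_le_tangent:
  fixes x y :: real
  assumes "0 \<le> x" "x \<le> pi" "0 \<le> y" "y \<le> pi"
  shows "sin y \<le> sin x + cos x * (y - x)"
proof (cases x y rule: linorder_cases)
  case less
  obtain z where z: "x < z" "z < y" "sin y - sin x = (y - x) * cos z"
    using MVT2[OF less, of sin cos] by (auto simp: DERIV_sin)
  have "cos z \<le> cos x" using z assms by (intro cos_monotone_0_pi_le) auto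
  then have "(y - x) * cos z \<le> (y - x) * cos x" using less by (intro mult_left_mono) auto
  then show ?thesis using z(3) by (simp add: algebra_simps)
next
  case greater
  obtain z where z: "y < z" "z < x" "sin x - sin y = (x - y) * cos z"
    using MVT2[OF greater, of sin cos] by (auto simp: DERIV_sin)
  have "cos x \<le> cos z" using z assms by (intro cos_monotone_0_pi_le) auto
  then have "(x - y) * cos x \<le> (x - y) * cos z" using greater by (intro mult_left_mono) auto
  then show ?thesis using z(3) by (simp add: algebra_simps)
qed auto

text \<open>The left side is the tangent of \<open>1 / s\<^sup>2\<close> at \<open>q\<close>; the
  gap is a positive multiple of \<open>(s - q)\<^sup>2 * (2 * s + q)\<close>.\<close>

lemma inverse_square_ge_tangent:
  fixes s q :: real
  assumes "0 < s" "0 < q"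
  shows "3 / q\<^sup>2 - 2 * s / q ^ 3 \<le> 1 / s\<^sup>2"
proof -
  have "0 \<le> (s - q)\<^sup>2 * (2 * s + q)" using assms by auto
  also have "\<dots> = q ^ 3 - (3 * q * s\<^sup>2 - 2 * s ^ 3)" by (simp add: algebra_simps power2_eq_square power3_eq_cube)
  finally have "3 * q * s\<^sup>2 - 2 * s ^ 3 \<le> q ^ 3" by simp
  then have "(3 * q * s\<^sup>2 - 2 * s ^ 3) / (q ^ 3 * s\<^sup>2) \<le> q ^ 3 / (q ^ 3 * s\<^sup>2)"
    using assms by (intro divide_right_mono) auto
  moreover have "(3 * q * s\<^sup>2 - 2 * s ^ 3) / (q ^ 3 * s\<^sup>2) = 3 / q\<^sup>2 - 2 * s / q ^ 3"
    using assms by (simp add: field_simps power2_eq_square power3_eq_cube)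
  ultimately show ?thesis using assms by simp
qed

text \<open>An interior \<open>a j\<close> collects weight \<open>j\<close> from
  \<open>k = j\<close> and \<open>n - j\<close> from \<open>k = j - 1\<close>, in total
  \<open>n\<close>, while \<open>a 0\<close> and \<open>a n\<close> get weight 0. Averaging
  neighbours this way keeps the end entries out of the angle estimate.\<close>

lemma sum_neighbour_averages:
  fixes a :: "nat \<Rightarrow> real"
  assumes "n \<ge> 1"
  shows "(\<Sum>k<n. (real k * a k + (real n - 1 - real k) * a (Suc k))) = real n * (\<Sum>k\<in>{1..<n}. a k)"
proof -
  \<comment> \<open>The constant \<open>c\<close> is separated from the summation bound for the
    induction; the correction term vanishes at \<open>m = c = n\<close>.\<close>
  have "(\<Sum>k<m. (real k * a k + (c - 1 - real k) * a (Suc k)))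
      = c * (\<Sum>k\<in>{1..<m}. a k) + (if m = 0 then 0 else (c - real m) * a m)" for m c
    by (induction m) (auto simp: algebra_simps)
  from this[of "real n" n] assms show ?thesis by simp
qed

text \<open>Convexity of \<open>1 / sin\<^sup>2\<close> bounds \<open>\<Sum>k. 1 / sin\<^sup>2 (\<theta> k)\<close> from below by \<open>n / sin\<^sup>2 (\<pi> / (2 n))\<close>
  as soon as the angles sum to less than \<open>\<pi> / 2\<close>.\<close>

lemma path_angle_sum_ge:
  fixes a :: "nat \<Rightarrow> real"
  assumes n: "n \<ge> 3" and a: "\<And>k. k \<le> n \<Longrightarrow> 0 \<le> a k" and \<epsilon>: "0 < \<epsilon>"
    and tr: "(1 / cos (pi / real n) - 1) / real n * (\<Sum>k\<in>{1..<n}. a k) \<le> \<epsilon>"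
    and \<theta>: "\<And>k. k < n \<Longrightarrow> 0 \<le> \<theta> k \<and> \<theta> k \<le> pi / 2"
    and cos\<theta>: "\<And>k. k < n \<Longrightarrow> (cos (\<theta> k))\<^sup>2 = a k * a (Suc k) / ((a k + \<epsilon>) * (a (Suc k) + \<epsilon>))"
  shows "pi / 2 \<le> (\<Sum>k<n. \<theta> k)"
proof (rule ccontr)
  assume "\<not> pi / 2 \<le> (\<Sum>k<n. \<theta> k)"
  then have less: "(\<Sum>k<n. \<theta> k) < pi / 2" by simp
  define t where "t = (\<Sum>k\<in>{1..<n}. a k)"
  have t0: "0 \<le> t" unfolding t_def using a by (intro sum_nonneg) auto
  \<comment> \<open>The common angle if \<open>n\<close> equal angles add up to
    \<open>pi / 2\<close>; all tangents are taken there.\<close>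
  define x where "x = pi / (2 * real n)"
  have x: "0 < x" "x < pi / 4" using n by (auto simp: x_def field_simps)
  define q where "q = sin x"
  have q: "0 < q" unfolding q_def using x by (intro sin_gt_zero) auto
  have cosx: "0 < cos x" using x by (intro cos_gt_zero) auto
  have cos2x: "0 < cos (2 * x)" using x by (intro cos_gt_zero) auto
  \<comment> \<open>A weighted mean, hence at least the smaller neighbour, chosen so that the total
    is a multiple of the interior trace \<open>t\<close>.\<close>
  define m where "m k = (real k * a k + (real n - 1 - real k) * a (Suc k)) / (real n - 1)" for k
  have m: "min (a k) (a (Suc k)) \<le> m k" if "k < n" for k
  proof -
    let ?u = "min (a k) (a (Suc k))"
    have "real k * ?u + (real n - 1 - real k) * ?u \<le> real k * a k + (real n - 1 - real k) * a (Suc k)"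
      using that by (intro add_mono mult_left_mono) auto
    then show ?thesis using n by (simp add: m_def field_simps)
  qed
  have sum_m: "(\<Sum>k<n. m k) = real n * t / (real n - 1)"
    using sum_neighbour_averages[of n a] n
    by (simp add: m_def t_def sum_divide_distrib[symmetric])
  have inv: "0 < sin (\<theta> k) \<and> 1 / (sin (\<theta> k))\<^sup>2 \<le> (m k + \<epsilon>) / \<epsilon>" if k: "k < n" for k
  proof -
    have ak: "0 \<le> a k" "0 \<le> a (Suc k)" using a k by auto
    \<comment> \<open>The factor of the larger neighbour \<open>v\<close> is at most 1 and is
      dropped; the smaller one is then replaced by the mean \<open>m k\<close>.\<close>
    define u where "u = min (a k) (a (Suc k))"
    define v where "v = max (a k) (a (Suc k))"
    have uv: "0 \<le> u" "0 \<le> v" "u \<le> m k" using ak m[OF k] by (auto simp: u_def v_def)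
    have "(cos (\<theta> k))\<^sup>2 = u / (u + \<epsilon>) * (v / (v + \<epsilon>))"
      unfolding cos\<theta>[OF k] u_def v_def by (simp add: min_def max_def mult.commute)
    also have "\<dots> \<le> u / (u + \<epsilon>) * 1" using uv \<epsilon> by (intro mult_left_mono) auto
    also have "\<dots> \<le> m k / (m k + \<epsilon>)" using uv \<epsilon> by (simp add: field_simps)
    finally have "1 - m k / (m k + \<epsilon>) \<le> (sin (\<theta> k))\<^sup>2" by (simp add: cos_squared_eq)
    moreover have "1 - m k / (m k + \<epsilon>) = \<epsilon> / (m k + \<epsilon>)" using uv \<epsilon> by (simp add: field_simps)
    ultimately have *: "\<epsilon> / (m k + \<epsilon>) \<le> (sin (\<theta> k))\<^sup>2" by simp
    have pos: "0 < \<epsilon> / (m k + \<epsilon>)" using uv \<epsilon> by simp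
    then have "sin (\<theta> k) \<noteq> 0" using * by auto
    moreover have "0 \<le> sin (\<theta> k)" using \<theta>[OF k] by (intro sin_ge_zero) auto
    moreover have "1 / (sin (\<theta> k))\<^sup>2 \<le> 1 / (\<epsilon> / (m k + \<epsilon>))"
      using * pos by (intro divide_left_mono mult_pos_pos less_le_trans[OF pos *]) auto
    ultimately show ?thesis by simp
  qed
  have "(\<Sum>k<n. sin (\<theta> k)) \<le> (\<Sum>k<n. q + cos x * (\<theta> k - x))"
  proof (intro sum_mono)
    fix k assume "k \<in> {..<n}"
    with \<theta>[of k] x show "sin (\<theta> k) \<le> q + cos x * (\<theta> k - x)"
      unfolding q_def by (intro sin_le_tangent) auto
  qed
  also have "\<dots> = real n * q + cos x * ((\<Sum>k<n. \<theta> k) - pi / 2)"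
  proof -
    have "real n * x = pi / 2" using n by (simp add: x_def)
    then show ?thesis by (simp add: sum.distrib sum_subtractf flip: sum_distrib_left)
  qed
  also have "\<dots> < real n * q" using cosx less by (simp add: mult_pos_neg)
  finally have sin_sum: "(\<Sum>k<n. sin (\<theta> k)) < real n * q" .
  have "real n / q\<^sup>2 = 3 * real n / q\<^sup>2 - 2 * (real n * q) / q ^ 3"
    using q by (simp add: field_simps power2_eq_square power3_eq_cube)
  also have "\<dots> < 3 * real n / q\<^sup>2 - 2 * (\<Sum>k<n. sin (\<theta> k)) / q ^ 3"
    using sin_sum q by (simp add: divide_strict_right_mono)
  also have "\<dots> = (\<Sum>k<n. 3 / q\<^sup>2 - 2 * sin (\<theta> k) / q ^ 3)"
    by (simp add: sum_subtractf sum_divide_distrib sum_distrib_left)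
  also have "\<dots> \<le> (\<Sum>k<n. (m k + \<epsilon>) / \<epsilon>)"
  proof (intro sum_mono)
    fix k assume "k \<in> {..<n}"
    then show "3 / q\<^sup>2 - 2 * sin (\<theta> k) / q ^ 3 \<le> (m k + \<epsilon>) / \<epsilon>"
      using inv[of k] inverse_square_ge_tangent[of "sin (\<theta> k)" q] q by auto
  qed
  also have "\<dots> = real n * (t / ((real n - 1) * \<epsilon>) + 1)"
    using \<epsilon> n by (simp add: sum_divide_distrib[symmetric] sum.distrib sum_m field_simps)
  finally have "real n * (1 / q\<^sup>2) < real n * (t / ((real n - 1) * \<epsilon>) + 1)" by simp
  then have "1 / q\<^sup>2 < t / ((real n - 1) * \<epsilon>) + 1" by (rule mult_left_less_imp_less) simp
  moreover have "1 / q\<^sup>2 - 1 = (cos x)\<^sup>2 / q\<^sup>2"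
    using q by (simp add: field_simps q_def cos_squared_eq)
  ultimately have "(cos x)\<^sup>2 / q\<^sup>2 < t / ((real n - 1) * \<epsilon>)" by simp
  then have A: "(real n - 1) * \<epsilon> * (cos x)\<^sup>2 < t * q\<^sup>2" using q \<epsilon> n by (simp add: field_simps)
  have "pi / real n = 2 * x" by (simp add: x_def)
  then have "(1 / cos (2 * x) - 1) / real n * t \<le> \<epsilon>" using tr by (simp add: t_def)
  then have "(1 - cos (2 * x)) * t \<le> \<epsilon> * (real n * cos (2 * x))"
    using n cos2x by (simp add: field_simps)
  moreover have "1 - cos (2 * x) = 2 * q\<^sup>2" by (simp add: cos_double_sin q_def)
  ultimately have "2 * (t * q\<^sup>2) \<le> \<epsilon> * (real n * cos (2 * x))"
    by (simp add: mult_ac)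
  \<comment> \<open>The cycle constant leaves slack: \<open>n \<le> 2 * (n - 1)\<close> and
    \<open>cos (2 * x) \<le> (cos x)\<^sup>2\<close>.\<close>
  also have "\<epsilon> * (real n * cos (2 * x)) \<le> \<epsilon> * (2 * (real n - 1) * (cos x)\<^sup>2)"
    using n \<epsilon> cos2x by (intro mult_left_mono mult_mono) (auto simp: cos_double)
  finally show False using A by (simp add: algebra_simps)
qed

text \<open>The completion is an entrywise product of a planar configuration turning from angle 0 to
  a right angle with a Markov chain. The planar factor fixes the lengths and makes the ends
  orthogonal; the chain lowers the absolute value of each neighbouring entry and gives it its
  sign.\<close>

lemma psd_path_completion_orthogonal_ends:
  fixes a b :: "nat \<Rightarrow> real"
  assumes n: "n \<ge> 3" and a: "\<And>k. k \<le> n \<Longrightarrow> 0 \<le> a k" and \<epsilon>: "0 < \<epsilon>"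
    and b: "\<And>k. k < n \<Longrightarrow> (b k)\<^sup>2 \<le> a k * a (Suc k)"
    and tr: "(1 / cos (pi / real n) - 1) / real n * (\<Sum>k\<in>{1..<n}. a k) \<le> \<epsilon>"
  obtains P where "psd_on {..n} P" "\<And>k. k \<le> n \<Longrightarrow> P k k = a k + \<epsilon>"
    "\<And>k. k < n \<Longrightarrow> P k (Suc k) = b k" "P 0 n = 0"
proof -
  define g where "g k = sqrt (a k + \<epsilon>)" for k
  have g: "0 < g k" "(g k)\<^sup>2 = a k + \<epsilon>" if "k \<le> n" for k
    using a[OF that] \<epsilon> by (auto simp: g_def)
  define \<rho> where "\<rho> k = sqrt (a k * a (Suc k)) / (g k * g (Suc k))" for k
  have \<rho>: "0 \<le> \<rho> k" "\<rho> k \<le> 1" if "k < n" for k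
  proof -
    have "sqrt (a k * a (Suc k)) \<le> sqrt ((a k + \<epsilon>) * (a (Suc k) + \<epsilon>))"
      using a[of k] a[of "Suc k"] that \<epsilon> by (intro real_sqrt_le_mono mult_mono) auto
    then show "\<rho> k \<le> 1" using g[of k] g[of "Suc k"] that
      by (simp add: \<rho>_def divide_le_eq_1 real_sqrt_mult g_def)
    show "0 \<le> \<rho> k" using g[of k] g[of "Suc k"] a[of k] a[of "Suc k"] that by (simp add: \<rho>_def)
  qed
  define \<theta> where "\<theta> k = arccos (\<rho> k)" for k
  have cos\<theta>: "cos (\<theta> k) = \<rho> k" and \<theta>: "0 \<le> \<theta> k" "\<theta> k \<le> pi / 2" if "k < n" for k
    using \<rho>[OF that] arccos_le_pi2[of "\<rho> k"] arccos_lbound[of "\<rho> k"] by (auto simp: \<theta>_def)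
  define \<Theta> where "\<Theta> = (\<Sum>k<n. \<theta> k)"
  have \<Theta>: "pi / 2 \<le> \<Theta>" unfolding \<Theta>_def
  proof (rule path_angle_sum_ge[OF n a \<epsilon> tr])
    fix k assume k: "k < n"
    show "(cos (\<theta> k))\<^sup>2 = a k * a (Suc k) / ((a k + \<epsilon>) * (a (Suc k) + \<epsilon>))"
      using a[of k] a[of "Suc k"] g[of k] g[of "Suc k"] k
      by (simp add: cos\<theta>[OF k] \<rho>_def power_divide power_mult_distrib)
  qed (use \<theta> in auto)
  \<comment> \<open>The angles are shrunk proportionally to total exactly \<open>pi / 2\<close>.
    Shrinking only raises the cosines, so there is still room for \<open>b k\<close>.\<close>
  define \<Delta> where "\<Delta> k = \<theta> k * (pi / 2 / \<Theta>)" for k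
  have \<Theta>0: "0 < \<Theta>" using \<Theta> pi_gt_zero by linarith
  have \<Delta>: "\<rho> k \<le> cos (\<Delta> k)" if "k < n" for k
  proof -
    have "pi / 2 / \<Theta> \<le> 1" using \<Theta> \<Theta>0 by (simp add: divide_le_eq_1)
    then have "\<Delta> k \<le> \<theta> k * 1" unfolding \<Delta>_def using \<theta>[OF that] by (intro mult_left_mono) auto
    moreover have "0 \<le> \<Delta> k" unfolding \<Delta>_def using \<theta>[OF that] \<Theta>0 by auto
    ultimately show ?thesis
      using \<theta>[OF that] cos\<theta>[OF that] cos_monotone_0_pi_le[of "\<Delta> k" "\<theta> k"] by auto
  qed
  define \<alpha> where "\<alpha> k = (\<Sum>j<k. \<Delta> j)" for k
  have \<alpha>0: "\<alpha> 0 = 0" by (simp add: \<alpha>_def)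
  have \<alpha>n: "\<alpha> n = pi / 2"
    using \<Theta>0 by (simp add: \<alpha>_def \<Delta>_def sum_distrib_right[symmetric] \<Theta>_def[symmetric]
        sum_divide_distrib[symmetric])
  \<comment> \<open>The correlation the chain has to contribute; where the denominator is 0, so is
    \<open>b k\<close>.\<close>
  define r where "r k = b k / (g k * g (Suc k) * cos (\<Delta> k))" for k
  have bk: "\<bar>b k\<bar> \<le> g k * g (Suc k) * cos (\<Delta> k)" if "k < n" for k
  proof -
    have "\<bar>b k\<bar> \<le> sqrt (a k * a (Suc k))"
      using b[OF that] by (metis real_le_rsqrt power2_abs)
    also have "\<dots> = g k * g (Suc k) * \<rho> k"
      using g(1)[of k] g(1)[of "Suc k"] that by (simp add: \<rho>_def)
    also have "\<dots> \<le> g k * g (Suc k) * cos (\<Delta> k)"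
      using \<Delta>[OF that] g(1)[of k] g(1)[of "Suc k"] that by (intro mult_left_mono) auto
    finally show ?thesis .
  qed
  have r1: "\<bar>r k\<bar> \<le> 1" if "k < n" for k
  proof -
    have "0 \<le> g k * g (Suc k) * cos (\<Delta> k)" using bk[OF that] by linarith
    then have "\<bar>r k\<bar> = \<bar>b k\<bar> / (g k * g (Suc k) * cos (\<Delta> k))"
      unfolding r_def abs_divide by simp
    also have "\<dots> \<le> 1" using bk[OF that] \<open>0 \<le> g k * g (Suc k) * cos (\<Delta> k)\<close>
      by (intro divide_le_eq_1[THEN iffD2]) linarith
    finally show ?thesis .
  qed
  have rb: "g k * g (Suc k) * cos (\<Delta> k) * r k = b k" if "k < n" for k
    using bk[OF that] by (cases "g k * g (Suc k) * cos (\<Delta> k) = 0") (auto simp: r_def)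
  from psd_on_path_correlation[of n r, OF r1]
  obtain N where N: "psd_on {..n} N" "\<And>k. k \<le> n \<Longrightarrow> N k k = 1" "\<And>k. k < n \<Longrightarrow> N k (Suc k) = r k"
    by blast
  \<comment> \<open>The addition formula for \<open>cos (\<alpha> j - \<alpha> i)\<close> turns the
    entrywise product into a sum of two diagonal congruences of \<open>N\<close>.\<close>
  define P where "P i j = g i * cos (\<alpha> i) * N i j * (g j * cos (\<alpha> j))
    + g i * sin (\<alpha> i) * N i j * (g j * sin (\<alpha> j))" for i j
  have P: "P i j = g i * g j * cos (\<alpha> j - \<alpha> i) * N i j" for i j
    by (simp add: P_def cos_diff algebra_simps)
  have "psd_on {..n} P" unfolding P_def
    using psd_on_pullback[OF N(1), of "{..n}" "\<lambda>i. g i * cos (\<alpha> i)" "\<lambda>i. i"]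
      psd_on_pullback[OF N(1), of "{..n}" "\<lambda>i. g i * sin (\<alpha> i)" "\<lambda>i. i"]
    by (intro psd_on_add) auto
  moreover have "P k k = a k + \<epsilon>" if "k \<le> n" for k
    using g(2)[OF that] N(2)[OF that] by (simp add: P power2_eq_square)
  moreover have "P k (Suc k) = b k" if "k < n" for k
    using rb[OF that] N(3)[OF that] by (simp add: P \<alpha>_def)
  moreover have "P 0 n = 0" by (simp add: P \<alpha>0 \<alpha>n)
  ultimately show ?thesis using that by blast
qed

section \<open>Completability after a shift\<close>

abbreviation shifted :: "'a ugraph \<Rightarrow> ('a \<Rightarrow> 'a \<Rightarrow> real) \<Rightarrow> real \<Rightarrow> 'a \<Rightarrow> 'a \<Rightarrow> real" where
  "shifted K X \<epsilon> \<equiv> (\<lambda>i j. X i j + \<epsilon> * id_partial K i j)"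

lemma adj_refl: "i \<in> verts K \<Longrightarrow> adj K i i"
  by (simp add: adj_def)

lemma shifted_completable_iff:
  assumes "X \<in> partial_mats K"
  shows "shifted K X \<epsilon> \<in> psd_completable K \<longleftrightarrow>
    (\<exists>M. psd_on (verts K) M \<and> (\<forall>i j. adj K i j \<longrightarrow> M i j = X i j + \<epsilon> * id_partial K i j))"
proof -
  have "shifted K X \<epsilon> \<in> partial_mats K"
    using assms by (auto simp: partial_mats_def id_partial_def adj_refl)
  then show ?thesis by (simp add: psd_completable_def)
qed

lemma shifted_completable_mono:
  assumes "finite (verts K)" "X \<in> partial_mats K" "shifted K X \<epsilon> \<in> psd_completable K" "\<epsilon> \<le> \<delta>"
  shows "shifted K X \<delta> \<in> psd_completable K"
proof -
  obtain M where M: "psd_on (verts K) M" "\<And>i j. adj K i j \<Longrightarrow> M i j = X i j + \<epsilon> * id_partial K i j"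
    using assms shifted_completable_iff by blast
  define M' where "M' i j = M i j + (if i = j then \<delta> - \<epsilon> else 0)" for i j
  have "psd_on (verts K) M'" unfolding M'_def
    using assms by (intro psd_on_add M(1) psd_on_diag) auto
  moreover have "M' i j = X i j + \<delta> * id_partial K i j" if "adj K i j" for i j
    using M(2)[OF that] that by (auto simp: M'_def id_partial_def adj_def algebra_simps)
  ultimately show ?thesis using assms(2) shifted_completable_iff by blast
qed

text \<open>Bounds the set under the infimum of \<open>eps_at\<close> from below; a zero diagonal
  entry excludes negative shifts.\<close>

lemma shifted_completable_lower_bound:
  assumes "finite (verts K)" "X \<in> partial_mats K" "shifted K X \<epsilon> \<in> psd_completable K" "v \<in> verts K"
  shows "- X v v \<le> \<epsilon>"
proof -
  obtain M where M: "psd_on (verts K) M" "\<And>i j. adj K i j \<Longrightarrow> M i j = X i j + \<epsilon> * id_partial K i j"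
    using assms shifted_completable_iff by blast
  have "0 \<le> M v v" using psd_on_diag_nonneg[OF M(1)] assms by blast
  then show ?thesis using M(2)[OF adj_refl[OF assms(4)]] assms(4) by (simp add: id_partial_def)
qed

lemma eps_at_le:
  assumes "finite (verts K)" "verts K \<noteq> {}" "X \<in> partial_mats K" "shifted K X \<epsilon> \<in> psd_completable K"
  shows "eps_at K X \<le> \<epsilon>"
proof -
  obtain v where "v \<in> verts K" using assms by auto
  then have "bdd_below {\<epsilon>. shifted K X \<epsilon> \<in> psd_completable K}"
    using shifted_completable_lower_bound[OF assms(1,3)] by (intro bdd_belowI[of _ "- X v v"]) auto
  then show ?thesis unfolding eps_at_def using assms(4) by (intro cInf_lower) auto
qed

lemma edge_psd_partial: "X \<in> edge_psd K \<Longrightarrow> X \<in> partial_mats K"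
  by (simp add: edge_psd_def)

lemma edge_psd_diag: "X \<in> edge_psd K \<Longrightarrow> v \<in> verts K \<Longrightarrow> 0 \<le> X v v"
  using psd_on_diag_nonneg[of "{v}" X v] adj_refl[of v K] by (force simp: edge_psd_def)

lemma edge_psd_trace_nonneg: "X \<in> edge_psd K \<Longrightarrow> 0 \<le> ptrace K X"
  unfolding ptrace_def by (intro sum_nonneg edge_psd_diag)

lemma clique_psd_subset_edge_psd: "clique_psd K \<subseteq> edge_psd K"
proof
  fix X assume X: "X \<in> clique_psd K"
  have "psd_on {i, j} X" if "adj K i j" for i j
  proof -
    have "clique K {i, j}" using that by (auto simp: clique_def adj_def insert_commute)
    then show ?thesis using X by (auto simp: clique_psd_def)
  qed
  then show "X \<in> edge_psd K" using X by (simp add: clique_psd_def edge_psd_def)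
qed

text \<open>A crude shift that always works, with placeholders 0 as completion. It makes the infimum
  of \<open>eps_at\<close> one over a nonempty set and bounds the suprema by 1.\<close>

lemma shifted_trace_completable:
  assumes "finite (verts K)" "X \<in> edge_psd K"
  shows "shifted K X (ptrace K X) \<in> psd_completable K"
proof -
  let ?V = "verts K"
  have sym: "X i j = X j i" for i j using assms(2) by (auto simp: edge_psd_def partial_mats_def)
  have le: "- ((X i i * (x j)\<^sup>2 + X j j * (x i)\<^sup>2) / 2) \<le> x i * X i j * x j" if "i \<in> ?V" "j \<in> ?V" for i j x
  proof -
    have d: "0 \<le> X i i" "0 \<le> X j j" using edge_psd_diag[OF assms(2)] that by auto
    consider "i = j" | "i \<noteq> j" "adj K i j" | "\<not> adj K i j" by blast
    then show ?thesis
    proof cases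
      case 1
      have "0 \<le> X j j * (x j)\<^sup>2" using d by simp
      then show ?thesis using 1 by (simp add: power2_eq_square mult_ac)
    next
      case 2
      then have "psd_on {i, j} X" using assms(2) by (auto simp: edge_psd_def)
      \<comment> \<open>Coordinates are swapped so that \<open>X i i\<close> meets
        \<open>x j\<close>; the summed squares then factor into trace times squared norm.\<close>
      from psd_on_pair_form[OF this 2(1), of "x j" "x i"]
      have "0 \<le> X i i * (x j)\<^sup>2 + 2 * (x i * X i j * x j) + X j j * (x i)\<^sup>2" by (simp add: mult_ac)
      moreover have "- ((p + q) / 2) \<le> r" if "0 \<le> p + 2 * r + q" for p q r :: real
        using that by (simp add: field_simps)
      ultimately show ?thesis by blast
    next
      case 3
      then have "X i j = 0" using assms(2) by (auto simp: edge_psd_def partial_mats_def)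
      moreover have "0 \<le> X i i * (x j)\<^sup>2 + X j j * (x i)\<^sup>2" using d by simp
      ultimately show ?thesis by simp
    qed
  qed
  define M where "M i j = X i j + (if i = j then ptrace K X else 0)" for i j
  have "psd_on ?V M" unfolding psd_on_def
  proof (intro conjI ballI allI)
    fix x
    have "(\<Sum>i\<in>?V. \<Sum>j\<in>?V. (X i i * (x j)\<^sup>2 + X j j * (x i)\<^sup>2) / 2)
        = ((\<Sum>i\<in>?V. \<Sum>j\<in>?V. X i i * (x j)\<^sup>2) + (\<Sum>i\<in>?V. \<Sum>j\<in>?V. X j j * (x i)\<^sup>2)) / 2"
      by (simp only: sum.distrib flip: sum_divide_distrib)
    also have "(\<Sum>i\<in>?V. \<Sum>j\<in>?V. X j j * (x i)\<^sup>2) = (\<Sum>i\<in>?V. \<Sum>j\<in>?V. X i i * (x j)\<^sup>2)"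
      by (rule sum.swap)
    also have "(\<Sum>i\<in>?V. \<Sum>j\<in>?V. X i i * (x j)\<^sup>2) = ptrace K X * (\<Sum>j\<in>?V. (x j)\<^sup>2)"
      by (simp add: ptrace_def sum_product)
    finally have "(\<Sum>i\<in>?V. \<Sum>j\<in>?V. (X i i * (x j)\<^sup>2 + X j j * (x i)\<^sup>2) / 2)
        = ptrace K X * (\<Sum>j\<in>?V. (x j)\<^sup>2)"
      by (subst (asm) mult_2[symmetric]) simp
    then have "- (ptrace K X * (\<Sum>j\<in>?V. (x j)\<^sup>2))
        = (\<Sum>i\<in>?V. \<Sum>j\<in>?V. - ((X i i * (x j)\<^sup>2 + X j j * (x i)\<^sup>2) / 2))"
      by (simp only: sum_negf)
    also have "\<dots> \<le> (\<Sum>i\<in>?V. \<Sum>j\<in>?V. x i * X i j * x j)"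
      by (intro sum_mono le)
    finally have *: "- (ptrace K X * (\<Sum>j\<in>?V. (x j)\<^sup>2)) \<le> (\<Sum>i\<in>?V. \<Sum>j\<in>?V. x i * X i j * x j)" .
    have "(\<Sum>i\<in>?V. \<Sum>j\<in>?V. x i * M i j * x j)
      = (\<Sum>i\<in>?V. \<Sum>j\<in>?V. x i * X i j * x j + (if j = i then ptrace K X * (x i)\<^sup>2 else 0))"
      by (intro sum.cong refl) (auto simp: M_def algebra_simps power2_eq_square)
    also have "\<dots> = (\<Sum>i\<in>?V. \<Sum>j\<in>?V. x i * X i j * x j) + ptrace K X * (\<Sum>j\<in>?V. (x j)\<^sup>2)"
      using assms(1) by (simp add: sum.distrib sum_distrib_left)
    finally show "0 \<le> (\<Sum>i\<in>?V. \<Sum>j\<in>?V. x i * M i j * x j)" using * by linarith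
  qed (simp add: M_def sym)
  then show ?thesis
    unfolding shifted_completable_iff[OF edge_psd_partial[OF assms(2)]]
    by (intro exI[of _ M]) (auto simp: M_def id_partial_def adj_def)
qed

lemma eps_at_le_trace:
  assumes "finite (verts K)" "verts K \<noteq> {}" "X \<in> edge_psd K"
  shows "eps_at K X \<le> ptrace K X"
  using assms by (intro eps_at_le shifted_trace_completable edge_psd_partial)

text \<open>Strictness replaces attainment: some admissible shift lies below \<epsilon>, and
  admissibility is monotone.\<close>

lemma shifted_completable_if_eps_at_less:
  assumes "finite (verts K)" "X \<in> edge_psd K" "eps_at K X < \<epsilon>"
  shows "shifted K X \<epsilon> \<in> psd_completable K"
proof -
  have "\<exists>\<delta>\<in>{\<delta>. shifted K X \<delta> \<in> psd_completable K}. \<delta> < \<epsilon>"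
    using assms shifted_trace_completable[OF assms(1,2)] unfolding eps_at_def
    by (intro cInf_lessD) auto
  then show ?thesis using shifted_completable_mono[OF assms(1) edge_psd_partial[OF assms(2)]] by force
qed

lemma eps_at_le_eps_minus:
  assumes "finite (verts K)" "verts K \<noteq> {}" "X \<in> edge_psd K" "ptrace K X = 1"
  shows "eps_at K X \<le> eps_minus K"
proof -
  have "bdd_above {eps_at K X | X. X \<in> edge_psd K \<and> ptrace K X = 1}"
    using eps_at_le_trace[OF assms(1,2)] by (intro bdd_aboveI[of _ 1]) fastforce
  then show ?thesis unfolding eps_minus_def using assms by (intro cSup_upper) auto
qed

lemma eps_at_le_eps:
  assumes "finite (verts K)" "verts K \<noteq> {}" "X \<in> clique_psd K" "ptrace K X = 1"
  shows "eps_at K X \<le> eps K"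
proof -
  have "bdd_above {eps_at K X | X. X \<in> clique_psd K \<and> ptrace K X = 1}"
    using eps_at_le_trace[OF assms(1,2)] clique_psd_subset_edge_psd
    by (intro bdd_aboveI[of _ 1]) fastforce
  then show ?thesis unfolding eps_def using assms by (intro cSup_upper) auto
qed

text \<open>By homogeneity it suffices to rescale to trace 1. Trace 0 cannot be normalised, but then
  the trace shift is 0 and monotonicity suffices.\<close>

lemma shifted_completable_if_eps_minus_less:
  assumes "finite (verts K)" "verts K \<noteq> {}" "X \<in> edge_psd K"
    and "eps_minus K * ptrace K X < \<epsilon>" "0 < \<epsilon>"
  shows "shifted K X \<epsilon> \<in> psd_completable K"
proof (cases "ptrace K X = 0")
  case True
  then show ?thesis
    using shifted_completable_mono[OF assms(1) edge_psd_partial[OF assms(3)]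
        shifted_trace_completable[OF assms(1,3)]] assms(5) by simp
next
  case False
  define s where "s = ptrace K X"
  have s: "0 < s" using False edge_psd_trace_nonneg[OF assms(3)] by (simp add: s_def)
  define Y where "Y i j = 1 / s * X i j" for i j
  have Y: "Y \<in> edge_psd K"
    using assms(3) psd_on_scale[of _ X "1 / s"] s
    by (auto simp: edge_psd_def partial_mats_def Y_def[abs_def])
  have "ptrace K Y = 1"
    using s by (simp add: ptrace_def Y_def flip: sum_divide_distrib) (simp add: s_def ptrace_def)
  then have "eps_at K Y \<le> eps_minus K" using eps_at_le_eps_minus assms Y by blast
  also have "\<dots> < \<epsilon> / s" using assms(4) s by (simp add: s_def pos_less_divide_eq)
  finally have "shifted K Y (\<epsilon> / s) \<in> psd_completable K"
    using shifted_completable_if_eps_at_less assms(1) Y by blast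
  then obtain M where M: "psd_on (verts K) M"
      "\<And>i j. adj K i j \<Longrightarrow> M i j = Y i j + \<epsilon> / s * id_partial K i j"
    using shifted_completable_iff[OF edge_psd_partial[OF Y]] by blast
  have "s * M i j = X i j + \<epsilon> * id_partial K i j" if "adj K i j" for i j
    using M(2)[OF that] s by (simp add: Y_def field_simps)
  then show ?thesis
    unfolding shifted_completable_iff[OF edge_psd_partial[OF assms(3)]]
    using psd_on_scale[OF M(1), of s] s by (intro exI[of _ "\<lambda>i j. s * M i j"]) auto
qed

lemma eps_le:
  assumes K: "finite (verts K)" "verts K \<noteq> {}"
    and le: "\<And>X \<epsilon>. X \<in> clique_psd K \<Longrightarrow> ptrace K X = 1 \<Longrightarrow> B < \<epsilon> \<Longrightarrow> shifted K X \<epsilon> \<in> psd_completable K"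
  shows "eps K \<le> B"
  unfolding eps_def
proof (rule cSup_least)
  obtain v where v: "v \<in> verts K" using K by auto
  \<comment> \<open>A member of the set, since \<open>Sup\<close> of the empty set would carry no
    information.\<close>
  define U where "U i j = (if i = j then if i = v then 1 else 0 else (0::real))" for i j
  have "psd_on C U" if "clique K C" for C
    unfolding U_def using that K finite_subset by (intro psd_on_diag) (auto simp: clique_def)
  then have "U \<in> clique_psd K"
    using v by (auto simp: clique_psd_def partial_mats_def U_def adj_def)
  moreover have "ptrace K U = 1" using v K by (simp add: ptrace_def U_def)
  ultimately show "{eps_at K X | X. X \<in> clique_psd K \<and> ptrace K X = 1} \<noteq> {}" by blast
next
  fix y assume "y \<in> {eps_at K X | X. X \<in> clique_psd K \<and> ptrace K X = 1}"
  then obtain X where X: "y = eps_at K X" "X \<in> clique_psd K" "ptrace K X = 1" by blast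
  show "y \<le> B" unfolding X(1)
  proof (rule dense_ge)
    fix \<epsilon> assume "B < \<epsilon>"
    then show "eps_at K X \<le> \<epsilon>"
      using eps_at_le[OF K _ le] X clique_psd_subset_edge_psd edge_psd_partial by blast
  qed
qed

text \<open>Put the whole trace on \<open>v\<close>: the zero entry at \<open>w\<close> rules out
  negative shifts. Two vertices are essential, as \<open>singleton_eps\<close> shows.\<close>

lemma eps_minus_nonneg:
  assumes K: "finite (verts K)" and vw: "v \<in> verts K" "w \<in> verts K" "v \<noteq> w"
  shows "0 \<le> eps_minus K"
proof -
  define U where "U i j = (if i = j then if i = v then 1 else 0 else (0::real))" for i j
  have "psd_on {i, j} U" for i j unfolding U_def by (intro psd_on_diag) auto
  then have U: "U \<in> edge_psd K"
    using vw by (auto simp: edge_psd_def partial_mats_def U_def adj_def)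
  have "ptrace K U = 1" using vw K by (simp add: ptrace_def U_def)
  have "0 \<le> eps_at K U" unfolding eps_at_def
  proof (rule cInf_greatest)
    show "{\<epsilon>. shifted K U \<epsilon> \<in> psd_completable K} \<noteq> {}"
      using shifted_trace_completable[OF K U] by blast
    fix \<epsilon> assume "\<epsilon> \<in> {\<epsilon>. shifted K U \<epsilon> \<in> psd_completable K}"
    then show "0 \<le> \<epsilon>"
      using shifted_completable_lower_bound[OF K edge_psd_partial[OF U] _ vw(2)] vw
      by (simp add: U_def)
  qed
  also have "\<dots> \<le> eps_minus K" using eps_at_le_eps_minus[OF K _ U] vw \<open>ptrace K U = 1\<close> by blast
  finally show ?thesis .
qed

text \<open>The only entry is 1 and may be shifted down to 0. Because \<open>eps_minus\<close> is
  negative here, the one-vertex graph is handled apart from the main estimate.\<close>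

lemma singleton_eps:
  assumes K: "verts K = {v}"
  shows "eps K \<le> -1" "eps_minus K = -1"
proof -
  have fin: "finite (verts K)" "verts K \<noteq> {}" using K by auto
  have compl: "shifted K X \<epsilon> \<in> psd_completable K"
    if X: "X \<in> edge_psd K" "ptrace K X = 1" and \<epsilon>: "-1 \<le> \<epsilon>" for X \<epsilon>
  proof -
    have "psd_on (verts K) (\<lambda>_ _. 1 + \<epsilon>)" using \<epsilon> by (simp add: K psd_on_singletonI)
    moreover have "1 + \<epsilon> = X i j + \<epsilon> * id_partial K i j" if "adj K i j" for i j
      using that X(2) by (simp add: K adj_def ptrace_def id_partial_def)
    ultimately show ?thesis
      unfolding shifted_completable_iff[OF edge_psd_partial[OF X(1)]] by fastforce
  qed
  show "eps K \<le> -1"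
    using compl clique_psd_subset_edge_psd by (intro eps_le[OF fin]) fastforce
  have eq: "eps_at K X = -1" if X: "X \<in> edge_psd K" "ptrace K X = 1" for X
  proof (rule antisym)
    show "eps_at K X \<le> -1" using eps_at_le[OF fin edge_psd_partial] compl X by blast
    show "-1 \<le> eps_at K X" unfolding eps_at_def
    proof (rule cInf_greatest)
      show "{\<epsilon>. shifted K X \<epsilon> \<in> psd_completable K} \<noteq> {}" using compl[OF X] by blast
      fix \<epsilon> assume "\<epsilon> \<in> {\<epsilon>. shifted K X \<epsilon> \<in> psd_completable K}"
      then show "-1 \<le> \<epsilon>"
        using shifted_completable_lower_bound[OF fin(1) edge_psd_partial[OF X(1)], of \<epsilon> v] X(2)
        by (simp add: K ptrace_def)
    qed
  qed
  define U where "U i j = (if i = v \<and> j = v then 1 else (0::real))" for i j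
  have "U \<in> edge_psd K"
    using K by (auto simp: edge_psd_def partial_mats_def U_def adj_def psd_on_def)
  moreover have "ptrace K U = 1" by (simp add: ptrace_def K U_def)
  ultimately have "{eps_at K X | X. X \<in> edge_psd K \<and> ptrace K X = 1} = {-1}"
    using eq by force
  then show "eps_minus K = -1" by (simp add: eps_minus_def)
qed

section \<open>Frustrated cycles\<close>

text \<open>The triangles \<open>0, k, k + 1\<close> are tested with the linear relation between the vectors
  \<open>(cos (j * \<pi> / l), sin (j * \<pi> / l))\<close>, \<open>j = 0, k, k + 1\<close>; the resulting inequalities telescope.\<close>

lemma frustrated_cycle_bound:
  assumes l: "l \<ge> 3" and M: "psd_on {..<l} M"
    and d: "\<And>k. k < l \<Longrightarrow> M k k = d" and b: "\<And>k. Suc k < l \<Longrightarrow> M k (Suc k) = b"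
    and last: "M 0 (l - 1) = - b"
  shows "b \<le> d * cos (pi / real l)"
proof -
  define \<phi> where "\<phi> = pi / real l"
  have l\<phi>: "real l * \<phi> = pi" using l by (simp add: \<phi>_def)
  have \<phi>: "0 < \<phi>" using l by (simp add: \<phi>_def)
  have s_pos: "0 < sin (real k * \<phi>)" if "1 \<le> k" "k < l" for k
  proof (rule sin_gt_zero)
    have "real k * \<phi> < real l * \<phi>" using that \<phi> by (intro mult_strict_right_mono) auto
    then show "real k * \<phi> < pi" by (simp add: l\<phi>)
  qed (use that \<phi> in auto)
  have S: "0 < sin \<phi>" using s_pos[of 1] l by simp
  \<comment> \<open>Both sides agree for the planar configuration with step angle
    \<open>\<phi>\<close>, where \<open>b = d * cos \<phi>\<close> and
    \<open>M 0 k = d * cos (k * \<phi>)\<close>.\<close>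
  have main: "sin (real k * \<phi>) * real k * b - d * (real k * cos \<phi> * sin (real k * \<phi>) - sin \<phi> * cos (real k * \<phi>))
      \<le> M 0 k * sin \<phi>" if "1 \<le> k" "k < l" for k
    using that
  proof (induction k rule: nat_induct_at_least)
    case base
    have "M 0 1 = b" using b[of 0] l by simp
    then show ?case by (simp add: algebra_simps)
  next
    case (Suc k)
    define s where "s = sin (real k * \<phi>)"
    define c where "c = cos (real k * \<phi>)"
    define s' where "s' = sin (real (Suc k) * \<phi>)"
    define c' where "c' = cos (real (Suc k) * \<phi>)"
    have s': "s' = s * cos \<phi> + c * sin \<phi>" and c': "c' = c * cos \<phi> - s * sin \<phi>"
      unfolding s'_def c'_def s_def c_def by (simp_all add: distrib_right sin_add cos_add add.commute)
    have pos: "0 < s" "0 < s'" using s_pos[of k] s_pos[of "Suc k"] Suc by (auto simp: s_def s'_def)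
    have sc: "s\<^sup>2 + c\<^sup>2 = 1" "(sin \<phi>)\<^sup>2 + (cos \<phi>)\<^sup>2 = 1" by (simp_all add: s_def c_def)
    have "psd_on {0, k, Suc k} M"
      using Suc by (intro psd_on_subset[OF M]) auto
    \<comment> \<open>With \<open>v j = (cos (j * \<phi>), sin (j * \<phi>))\<close>, these are the
      coefficients of the relation between \<open>v 0\<close>, \<open>v k\<close> and
      \<open>v (Suc k)\<close>.\<close>
    from psd_on_triple_form[OF this, of "sin \<phi>" "- s'" s]
    have "0 \<le> d * ((sin \<phi>)\<^sup>2 + s'\<^sup>2 + s\<^sup>2) + 2 * (- M 0 k * sin \<phi> * s' + M 0 (Suc k) * sin \<phi> * s - b * s' * s)"
      using d[of 0] d[of k] d[of "Suc k"] b[of k] Suc by (simp add: algebra_simps)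
    moreover have "(s * real k * b - d * (real k * cos \<phi> * s - sin \<phi> * c)) * s' \<le> M 0 k * sin \<phi> * s'"
      using Suc pos by (intro mult_right_mono) (auto simp: s_def c_def)
    ultimately have "2 * ((s * real k * b - d * (real k * cos \<phi> * s - sin \<phi> * c)) * s' + b * s' * s)
        - d * ((sin \<phi>)\<^sup>2 + s'\<^sup>2 + s\<^sup>2) \<le> 2 * (M 0 (Suc k) * sin \<phi> * s)"
      by (simp add: algebra_simps)
    \<comment> \<open>In this form the term with \<open>s' * c\<close> cancels against the induction
      hypothesis, and the factor \<open>s\<close> divides out of the rest.\<close>
    moreover have "(sin \<phi>)\<^sup>2 + s'\<^sup>2 + s\<^sup>2 = 2 * (cos \<phi> * s * s' + sin \<phi> * (s' * c - c' * s))"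
      using sc unfolding s' c' by algebra
    ultimately have "2 * ((s * real k * b - d * (real k * cos \<phi> * s - sin \<phi> * c)) * s' + b * s' * s)
        - d * (2 * (cos \<phi> * s * s' + sin \<phi> * (s' * c - c' * s))) \<le> 2 * (M 0 (Suc k) * sin \<phi> * s)"
      by (simp only:)
    then have "s * (s' * (real k + 1) * b - d * ((real k + 1) * cos \<phi> * s' - sin \<phi> * c'))
        \<le> s * (M 0 (Suc k) * sin \<phi>)"
      by (simp add: algebra_simps)
    then have "s' * (real k + 1) * b - d * ((real k + 1) * cos \<phi> * s' - sin \<phi> * c') \<le> M 0 (Suc k) * sin \<phi>"
      using pos by simp
    then show ?case by (simp add: s'_def c'_def add.commute)
  qed
  \<comment> \<open>At the last vertex the angle is \<open>pi - \<phi>\<close>, and the closing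
    entry \<open>- b\<close> adds one more \<open>b\<close> to the \<open>l - 1\<close>
    collected.\<close>
  have "real (l - 1) * \<phi> = pi - \<phi>" using l l\<phi> by (simp add: of_nat_diff algebra_simps)
  with main[of "l - 1"] l last
  have "sin \<phi> * real (l - 1) * b - d * (real (l - 1) * cos \<phi> * sin \<phi> + sin \<phi> * cos \<phi>) \<le> - b * sin \<phi>"
    by simp
  then have "sin \<phi> * (real l * b) \<le> sin \<phi> * (real l * (d * cos \<phi>))"
    using l by (simp add: of_nat_diff algebra_simps)
  then show ?thesis using S l by (simp add: \<phi>_def)
qed

text \<open>Every edge block is singular, so neighbours are forced to be equal, or opposite on the
  closing edge. The single sign change makes these demands incompatible around the cycle.\<close>

definition frustrated_cycle :: "nat \<Rightarrow> nat \<Rightarrow> nat \<Rightarrow> real" where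
  "frustrated_cycle l i j =
     (if \<not> adj (cycle_graph l) i j then 0 else if {i, j} = {0, l - 1} then - 1 / real l else 1 / real l)"

lemma adj_cycle_graph:
  "adj (cycle_graph l) i j \<longleftrightarrow> i < l \<and> j < l \<and> (i = j \<or> j = Suc i mod l \<or> i = Suc j mod l)"
  by (auto simp: adj_def cycle_graph_def doubleton_eq_iff)

lemma frustrated_cycle_edge_psd:
  assumes "l \<ge> 3"
  shows "frustrated_cycle l \<in> edge_psd (cycle_graph l)"
proof -
  have adj_sym: "adj (cycle_graph l) i j = adj (cycle_graph l) j i" for i j
    by (auto simp: adj_cycle_graph)
  have sym: "frustrated_cycle l i j = frustrated_cycle l j i" for i j
    by (simp add: frustrated_cycle_def adj_sym[of i j] insert_commute)
  have diag: "frustrated_cycle l i i = 1 / real l" if "i < l" for i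
    using that assms by (auto simp: frustrated_cycle_def adj_cycle_graph)
  have "psd_on {i, j} (frustrated_cycle l)" if "adj (cycle_graph l) i j" for i j
  proof (cases "i = j")
    case True
    then show ?thesis using that by (simp add: psd_on_def diag adj_cycle_graph)
  next
    case False
    moreover have "(frustrated_cycle l i j)\<^sup>2 \<le> 1 / real l * (1 / real l)"
      by (simp add: frustrated_cycle_def power2_eq_square)
    ultimately show ?thesis
      using that by (intro psd_on_pairI) (auto simp: sym diag adj_cycle_graph)
  qed
  then show ?thesis using sym by (simp add: edge_psd_def partial_mats_def) (simp add: frustrated_cycle_def)
qed

lemma frustrated_cycle_trace:
  assumes "l \<ge> 3"
  shows "ptrace (cycle_graph l) (frustrated_cycle l) = 1"
proof -
  have "frustrated_cycle l i i = 1 / real l" if "i < l" for i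
    using that assms by (auto simp: frustrated_cycle_def adj_cycle_graph)
  then show ?thesis using assms by (simp add: ptrace_def cycle_graph_def)
qed

text \<open>From four vertices on a cycle has no triangle, so the clique condition reduces to the
  edge condition. The triangle itself escapes this and enters through
  \<open>eps_minus\<close>.\<close>

lemma cycle_clique_doubleton:
  assumes l: "l \<ge> 4" and C: "clique (cycle_graph l) C" "C \<noteq> {}"
  obtains i j where "adj (cycle_graph l) i j" "C = {i, j}"
proof -
  have adj: "adj (cycle_graph l) i j" if "i \<in> C" "j \<in> C" for i j
    using C that by (auto simp: clique_def)
  have Suc_mod: "Suc i mod l = (if Suc i = l then 0 else Suc i)" if "i < l" for i
    using that by (auto simp: mod_less)
  obtain i where i: "i \<in> C" using C by auto
  show thesis
  proof (cases "C = {i}")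
    case True
    then show thesis using that[of i i] adj[OF i i] by simp
  next
    case False
    then obtain j where j: "j \<in> C" "j \<noteq> i" using i by auto
    have "k = i \<or> k = j" if "k \<in> C" for k
    proof (rule ccontr)
      assume k: "\<not> (k = i \<or> k = j)"
      have "i < l" "j < l" "k < l" using adj i j that by (auto simp: adj_cycle_graph)
      with adj[OF i j(1)] adj[OF i that] adj[OF j(1) that] j(2) k l show False
        by (auto simp: adj_cycle_graph Suc_mod split: if_splits)
    qed
    then show thesis using that[of i j] adj[OF i j(1)] i j by blast
  qed
qed

lemma frustrated_cycle_clique_psd:
  assumes "l \<ge> 4"
  shows "frustrated_cycle l \<in> clique_psd (cycle_graph l)"
proof -
  have "psd_on C (frustrated_cycle l)" if "clique (cycle_graph l) C" for C
  proof (cases "C = {}")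
    case False
    then show ?thesis
      using cycle_clique_doubleton[OF assms that] frustrated_cycle_edge_psd[of l] assms
      by (auto simp: edge_psd_def)
  qed (simp add: psd_on_def)
  then show ?thesis
    using frustrated_cycle_edge_psd[of l] assms by (simp add: edge_psd_def clique_psd_def)
qed

lemma eps_at_frustrated_cycle_ge:
  assumes l: "l \<ge> 3"
  shows "(1 / cos (pi / real l) - 1) / real l \<le> eps_at (cycle_graph l) (frustrated_cycle l)"
  unfolding eps_at_def
proof (rule cInf_greatest)
  let ?K = "cycle_graph l" and ?X = "frustrated_cycle l"
  have fin: "finite (verts ?K)" by (simp add: cycle_graph_def)
  show "{\<epsilon>. shifted ?K ?X \<epsilon> \<in> psd_completable ?K} \<noteq> {}"
    using shifted_trace_completable[OF fin frustrated_cycle_edge_psd[OF l]] by blast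
  fix \<epsilon> assume "\<epsilon> \<in> {\<epsilon>. shifted ?K ?X \<epsilon> \<in> psd_completable ?K}"
  then obtain M where M: "psd_on (verts ?K) M"
      "\<And>i j. adj ?K i j \<Longrightarrow> M i j = ?X i j + \<epsilon> * id_partial ?K i j"
    using shifted_completable_iff[OF edge_psd_partial[OF frustrated_cycle_edge_psd[OF l]]] by blast
  have "1 / real l \<le> (1 / real l + \<epsilon>) * cos (pi / real l)"
  proof (rule frustrated_cycle_bound[OF l])
    show "psd_on {..<l} M" using M(1) by (simp add: cycle_graph_def)
    show "M k k = 1 / real l + \<epsilon>" if "k < l" for k
    proof -
      have "k \<in> verts ?K" using that by (simp add: cycle_graph_def)
      then show ?thesis using M(2)[of k k] that l
        by (auto simp: adj_cycle_graph frustrated_cycle_def id_partial_def)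
    qed
    show "M k (Suc k) = 1 / real l" if "Suc k < l" for k
      using M(2)[of k "Suc k"] that l
      by (auto simp: adj_cycle_graph frustrated_cycle_def id_partial_def doubleton_eq_iff)
    show "M 0 (l - 1) = - (1 / real l)"
      using M(2)[of 0 "l - 1"] l
      by (auto simp: adj_cycle_graph frustrated_cycle_def id_partial_def)
  qed
  moreover have "0 < cos (pi / real l)"
  proof (rule cos_gt_zero)
    show "pi / real l < pi / 2" using l by (intro divide_strict_left_mono) auto
  qed (use l in auto)
  ultimately show "(1 / cos (pi / real l) - 1) / real l \<le> \<epsilon>"
    using l by (simp add: field_simps)
qed

text \<open>The lower bound drives the main estimate; the upper bound 1 fixes the sign of
  \<open>c - 2\<close> for one-vertex graphs in \<open>eps_lengthen_le\<close>.\<close>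

lemma cycle_eps_bounds:
  assumes "l \<ge> 4"
  shows "(1 / cos (pi / real l) - 1) / real l \<le> eps (cycle_graph l)" "eps (cycle_graph l) \<le> 1"
proof -
  have K: "finite (verts (cycle_graph l))" "verts (cycle_graph l) \<noteq> {}"
    using assms by (auto simp: cycle_graph_def lessThan_empty_iff)
  have "eps_at (cycle_graph l) (frustrated_cycle l) \<le> eps (cycle_graph l)"
    using assms by (intro eps_at_le_eps K frustrated_cycle_clique_psd frustrated_cycle_trace) auto
  then show "(1 / cos (pi / real l) - 1) / real l \<le> eps (cycle_graph l)"
    using eps_at_frustrated_cycle_ge[of l] assms by linarith
  have "eps_at (cycle_graph l) X \<le> 1" if "X \<in> clique_psd (cycle_graph l)" "ptrace (cycle_graph l) X = 1" for X
    using eps_at_le_trace[OF K, of X] that clique_psd_subset_edge_psd by auto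
  then show "eps (cycle_graph l) \<le> 1" unfolding eps_def
    using frustrated_cycle_clique_psd[OF assms] frustrated_cycle_trace[of l] assms
    by (intro cSup_least) auto
qed

lemma cycle_eps_minus_bounds:
  assumes "l \<ge> 3"
  shows "(1 / cos (pi / real l) - 1) / real l \<le> eps_minus (cycle_graph l)" "eps_minus (cycle_graph l) \<le> 1"
proof -
  have K: "finite (verts (cycle_graph l))" "verts (cycle_graph l) \<noteq> {}"
    using assms by (auto simp: cycle_graph_def lessThan_empty_iff)
  have "eps_at (cycle_graph l) (frustrated_cycle l) \<le> eps_minus (cycle_graph l)"
    using assms by (intro eps_at_le_eps_minus K frustrated_cycle_edge_psd frustrated_cycle_trace) auto
  then show "(1 / cos (pi / real l) - 1) / real l \<le> eps_minus (cycle_graph l)"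
    using eps_at_frustrated_cycle_ge[of l] assms by linarith
  have "eps_at (cycle_graph l) X \<le> 1" if "X \<in> edge_psd (cycle_graph l)" "ptrace (cycle_graph l) X = 1" for X
    using eps_at_le_trace[OF K, of X] that by auto
  then show "eps_minus (cycle_graph l) \<le> 1" unfolding eps_minus_def
    using frustrated_cycle_edge_psd[OF assms] frustrated_cycle_trace[of l] assms
    by (intro cSup_least) auto
qed

section \<open>Lengthened graphs\<close>

lemma edge_src_tgt:
  assumes "card e = 2"
  shows "edge_src e \<noteq> edge_tgt e" "e = {edge_src e, edge_tgt e}"
proof -
  obtain u v where e: "e = {u, v}" "u \<noteq> v" using assms by (auto simp: card_2_iff)
  have src: "edge_src e \<in> e" unfolding edge_src_def by (rule someI[of _ u]) (simp add: e)
  then have "\<exists>w. w \<in> e - {edge_src e}" using e by auto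
  then have tgt: "edge_tgt e \<in> e - {edge_src e}" unfolding edge_tgt_def by (rule someI_ex)
  show "edge_src e \<noteq> edge_tgt e" using tgt by auto
  show "e = {edge_src e, edge_tgt e}" using src tgt e by auto
qed

lemma is_graph_edge:
  assumes "is_graph G" "e \<in> edges G"
  shows "edge_src e \<in> verts G" "edge_tgt e \<in> verts G" "edge_src e \<noteq> edge_tgt e"
    "e = {edge_src e, edge_tgt e}" "adj G (edge_src e) (edge_tgt e)"
proof -
  have e: "card e = 2" "e \<subseteq> verts G" using assms by (auto simp: is_graph_def)
  note st = edge_src_tgt[OF e(1)]
  show "edge_src e \<in> verts G" "edge_tgt e \<in> verts G" "edge_src e \<noteq> edge_tgt e" "e = {edge_src e, edge_tgt e}"
    using st e by auto
  then show "adj G (edge_src e) (edge_tgt e)" using assms by (auto simp: adj_def)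
qed

lemma is_graph_finite_edges: "is_graph G \<Longrightarrow> finite (edges G)"
  by (rule finite_subset[of _ "Pow (verts G)"]) (auto simp: is_graph_def)

text \<open>Path matrices are indexed by \<open>0..l\<close>, path vertices by
  \<open>1..l + 1\<close>, so position \<open>k\<close> is always
  \<open>path_vertex l e (Suc k)\<close>.\<close>

lemma path_vertex_simps:
  "path_vertex l e (Suc 0) = Orig (edge_src e)"
  "0 < l \<Longrightarrow> path_vertex l e (Suc l) = Orig (edge_tgt e)"
  "0 < k \<Longrightarrow> k < l \<Longrightarrow> path_vertex l e (Suc k) = New e (Suc k)"
  by (auto simp: path_vertex_def)

lemma path_vertex_cases:
  assumes "k \<le> l" "0 < l"
  obtains "k = 0" "path_vertex l e (Suc k) = Orig (edge_src e)"
  | "k = l" "path_vertex l e (Suc k) = Orig (edge_tgt e)"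
  | "0 < k" "k < l" "path_vertex l e (Suc k) = New e (Suc k)"
proof -
  consider "k = 0" | "k = l" | "0 < k" "k < l" using assms(1) by linarith
  then show thesis using that assms(2) by cases (auto simp: path_vertex_simps)
qed

lemma verts_lengthen:
  "verts (lengthen l G) = Orig ` verts G \<union> (\<lambda>(e, i). New e i) ` (edges G \<times> {2..l})"
  by (auto simp: lengthen_def)

lemma finite_verts_lengthen: "is_graph G \<Longrightarrow> finite (verts (lengthen l G))"
  by (simp add: verts_lengthen is_graph_finite_edges) (simp add: is_graph_def)

lemma path_vertex_in_verts:
  assumes "is_graph G" "e \<in> edges G" "k \<le> l" "0 < l"
  shows "path_vertex l e (Suc k) \<in> verts (lengthen l G)"
  using assms(3,4)
  by (cases rule: path_vertex_cases[where e = e])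
    (use assms(2) is_graph_edge[OF assms(1,2)] in \<open>auto simp: verts_lengthen\<close>)

lemma adj_path_vertex:
  assumes "is_graph G" "e \<in> edges G" "k < l"
  shows "adj (lengthen l G) (path_vertex l e (Suc k)) (path_vertex l e (Suc (Suc k)))"
proof -
  have "{path_vertex l e (Suc k), path_vertex l e (Suc k + 1)} \<in> edges (lengthen l G)"
    unfolding lengthen_def ugraph.simps using assms
    by (intro CollectI exI[of _ e] exI[of _ "Suc k"]) auto
  then show ?thesis
    using path_vertex_in_verts[OF assms(1,2), of k l] path_vertex_in_verts[OF assms(1,2), of "Suc k" l] assms
    by (simp add: adj_def)
qed

lemma path_vertex_Suc_neq:
  assumes "is_graph G" "e \<in> edges G" "k < l"
  shows "path_vertex l e (Suc k) \<noteq> path_vertex l e (Suc (Suc k))"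
  using is_graph_edge(3)[OF assms(1,2)] assms(3) by (auto simp: path_vertex_def)

lemma adj_lengthenE:
  assumes "adj (lengthen l G) x y"
  obtains v where "x = Orig v" "y = Orig v" "v \<in> verts G"
  | e k where "x = New e (Suc k)" "y = New e (Suc k)" "e \<in> edges G" "0 < k" "k < l"
  | e k where "e \<in> edges G" "k < l" "{x, y} = {path_vertex l e (Suc k), path_vertex l e (Suc (Suc k))}"
proof (cases "x = y")
  case True
  then have "x \<in> verts (lengthen l G)" using assms by (simp add: adj_def)
  then consider v where "x = Orig v" "v \<in> verts G" | e i where "x = New e i" "e \<in> edges G" "2 \<le> i" "i \<le> l"
    by (auto simp: verts_lengthen)
  then show thesis
  proof cases
    case 2
    then show thesis using that(2)[of e "i - 1"] True by (cases i) auto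
  qed (use that(1) True in auto)
next
  case False
  then have "{x, y} \<in> edges (lengthen l G)" using assms by (simp add: adj_def)
  then obtain e i where "{x, y} = {path_vertex l e i, path_vertex l e (i + 1)}" "e \<in> edges G" "1 \<le> i" "i \<le> l"
    by (auto simp: lengthen_def)
  then show thesis using that(3)[of e "i - 1"] by (cases i) auto
qed

lemma ptrace_lengthen:
  assumes "is_graph G"
  shows "ptrace (lengthen l G) X =
    (\<Sum>v\<in>verts G. X (Orig v) (Orig v)) + (\<Sum>e\<in>edges G. \<Sum>i\<in>{2..l}. X (New e i) (New e i))"
proof -
  have "inj_on (\<lambda>(e, i). New e i) (edges G \<times> {2..l})" by (auto simp: inj_on_def)
  then have "(\<Sum>x\<in>(\<lambda>(e, i). New e i) ` (edges G \<times> {2..l}). X x x)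
      = (\<Sum>e\<in>edges G. \<Sum>i\<in>{2..l}. X (New e i) (New e i))"
    unfolding sum.cartesian_product by (subst sum.reindex) (auto intro!: sum.cong)
  moreover have "inj_on Orig (verts G)" by (auto simp: inj_on_def)
  moreover have "Orig ` verts G \<inter> (\<lambda>(e, i). New e i) ` (edges G \<times> {2..l}) = {}" by auto
  moreover have "finite (verts G)" "finite (edges G)"
    using assms is_graph_finite_edges by (auto simp: is_graph_def)
  ultimately show ?thesis
    by (simp add: ptrace_def verts_lengthen sum.union_disjoint sum.reindex)
qed

section \<open>Gluing path completions to a completion on \<open>G\<close>\<close>

text \<open>The path completions are glued to \<open>MG\<close> along the pairs of end points: every path vector is
  a linear combination of the two end vectors plus a remainder, whose Gram matrix is a Schur
  complement, and remainders of different paths are taken orthogonal.\<close>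

lemma glue_path_completions:
  fixes G :: "'a ugraph"
  assumes G: "is_graph G" and l: "0 < l" and MG: "psd_on (verts G) MG"
    and P: "\<And>e. e \<in> edges G \<Longrightarrow> psd_on {..l} (P e)"
    and src: "\<And>e. e \<in> edges G \<Longrightarrow> P e 0 0 = MG (edge_src e) (edge_src e)"
    and tgt: "\<And>e. e \<in> edges G \<Longrightarrow> P e l l = MG (edge_tgt e) (edge_tgt e)"
    and mid: "\<And>e. e \<in> edges G \<Longrightarrow> P e 0 l = MG (edge_src e) (edge_tgt e)"
    and det: "\<And>e. e \<in> edges G \<Longrightarrow> P e 0 0 * P e l l \<noteq> (P e 0 l)\<^sup>2"
  obtains M where "psd_on (verts (lengthen l G)) M"
    "\<And>u v. u \<in> verts G \<Longrightarrow> v \<in> verts G \<Longrightarrow> M (Orig u) (Orig v) = MG u v"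
    "\<And>e i j. e \<in> edges G \<Longrightarrow> i \<le> l \<Longrightarrow> j \<le> l \<Longrightarrow>
      M (path_vertex l e (Suc i)) (path_vertex l e (Suc j)) = P e i j"
proof -
  have finE: "finite (edges G)" and finV: "finite (verts G)"
    using G is_graph_finite_edges by (auto simp: is_graph_def)
  define \<Phi> where "\<Phi> e p q R \<longleftrightarrow> psd_on {..l} R \<and> p 0 = 1 \<and> q 0 = 0 \<and> p l = 0 \<and> q l = 1
    \<and> (\<forall>j\<le>l. R 0 j = 0) \<and> (\<forall>j\<le>l. R l j = 0)
    \<and> (\<forall>i\<le>l. \<forall>j\<le>l. P e i j =
      p i * p j * P e 0 0 + (p i * q j + q i * p j) * P e 0 l + q i * q j * P e l l + R i j)"
    for e and p q :: "nat \<Rightarrow> real" and R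
  have "\<exists>p q R. \<Phi> e p q R" if e: "e \<in> edges G" for e
  proof -
    have ends: "finite {..l}" "0 \<in> {..l}" "l \<in> {..l}" "0 \<noteq> l" using l by auto
    show ?thesis
      by (rule psd_on_schur_complement[OF P[OF e] ends det[OF e]]) (unfold \<Phi>_def, blast)
  qed
  then obtain p q R where \<Phi>: "\<And>e. e \<in> edges G \<Longrightarrow> \<Phi> e (p e) (q e) (R e)" by metis
  \<comment> \<open>Coefficients of each vector over the vectors of \<open>G\<close>: a unit row for
    an original vertex, the Schur coefficients at the two ends for an interior one.\<close>
  define L where "L x a = (case x of Orig v \<Rightarrow> if a = v then 1 else 0
    | New e i \<Rightarrow> (if a = edge_src e then p e (i - 1) else 0) + (if a = edge_tgt e then q e (i - 1) else 0))"
    for x and a :: 'a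
  \<comment> \<open>\<open>w e\<close> selects the interior of path \<open>e\<close> and
    \<open>f\<close> recovers the position; the value 0 of \<open>f\<close> on original vertices is
    masked by \<open>w\<close>.\<close>
  define w where "w e x = (case x of Orig v \<Rightarrow> 0 | New e' i \<Rightarrow> if e' = e then 1 else (0::real))"
    for e and x :: "'a lvertex"
  define f where "f x = (case x of Orig v \<Rightarrow> 0 | New e i \<Rightarrow> i - 1)" for x :: "'a lvertex"
  define Q where "Q x y = (\<Sum>a\<in>verts G. \<Sum>b\<in>verts G. L x a * MG a b * L y b)" for x y
  define S where "S x y = (\<Sum>e\<in>edges G. w e x * R e (f x) (f y) * w e y)" for x y
  let ?W = "verts (lengthen l G)"
  have "psd_on ?W Q" unfolding Q_def by (rule psd_on_congruence[OF MG])
  moreover have "psd_on ?W S" unfolding S_def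
  proof (rule psd_on_sum)
    fix e assume "e \<in> edges G"
    then have "psd_on {..l} (R e)" using \<Phi> unfolding \<Phi>_def by blast
    then show "psd_on ?W (\<lambda>x y. w e x * R e (f x) (f y) * w e y)"
      by (rule psd_on_pullback) (auto simp: w_def f_def verts_lengthen)
  qed
  ultimately have psd: "psd_on ?W (\<lambda>x y. Q x y + S x y)" by (rule psd_on_add)
  have Q_eq: "Q x y = (\<Sum>a\<in>verts G. L x a * (\<Sum>b\<in>verts G. L y b * MG a b))" for x y
    by (simp add: Q_def sum_distrib_left mult_ac)
  have Orig: "Q (Orig u) (Orig v) + S (Orig u) (Orig v) = MG u v" if "u \<in> verts G" "v \<in> verts G" for u v
  proof -
    have "(\<Sum>a\<in>verts G. L (Orig t) a * h a) = h t" if "t \<in> verts G" for t h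
    proof -
      have "(\<Sum>a\<in>verts G. L (Orig t) a * h a) = (\<Sum>a\<in>verts G. if a = t then h a else 0)"
        by (intro sum.cong refl) (simp add: L_def)
      then show ?thesis using that finV by simp
    qed
    then show ?thesis using that by (simp add: Q_eq S_def w_def)
  qed
  have path: "Q (path_vertex l e (Suc i)) (path_vertex l e (Suc j))
      + S (path_vertex l e (Suc i)) (path_vertex l e (Suc j)) = P e i j"
    if e: "e \<in> edges G" and ij: "i \<le> l" "j \<le> l" for e i j
  proof -
    have ends: "p e 0 = 1" "q e 0 = 0" "p e l = 0" "q e l = 1"
      and R: "psd_on {..l} (R e)" "\<And>j. j \<le> l \<Longrightarrow> R e 0 j = 0" "\<And>j. j \<le> l \<Longrightarrow> R e l j = 0"
      and eq: "P e i j = p e i * p e j * P e 0 0 + (p e i * q e j + q e i * p e j) * P e 0 l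
        + q e i * q e j * P e l l + R e i j"
      using \<Phi>[OF e] ij unfolding \<Phi>_def by blast+
    note st = is_graph_edge[OF G e]
    have L: "(\<Sum>a\<in>verts G. L (path_vertex l e (Suc k)) a * h a) = p e k * h (edge_src e) + q e k * h (edge_tgt e)"
      if "k \<le> l" for k h
    proof -
      have "L (path_vertex l e (Suc k)) a * h a
          = (if a = edge_src e then p e k * h a else 0) + (if a = edge_tgt e then q e k * h a else 0)" for a
        using that l st(3)
        by (cases rule: path_vertex_cases[where e = e]) (auto simp: L_def ends)
      then show ?thesis using st finV by (simp add: sum.distrib)
    qed
    have "MG (edge_tgt e) (edge_src e) = MG (edge_src e) (edge_tgt e)"
      using psd_on_sym[OF MG] st by blast
    then have "Q (path_vertex l e (Suc i)) (path_vertex l e (Suc j)) + R e i j = P e i j"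
      unfolding Q_eq L[OF ij(1)] L[OF ij(2)] eq src[OF e] tgt[OF e] mid[OF e]
      by (simp add: algebra_simps)
    moreover have "S (path_vertex l e (Suc i)) (path_vertex l e (Suc j)) = R e i j"
    \<comment> \<open>At an end the remainder is zero, in agreement with \<open>w\<close> vanishing
      on original vertices.\<close>
    proof (cases "i = 0 \<or> i = l \<or> j = 0 \<or> j = l")
      case True
      have "R e i j = R e j i" using psd_on_sym[OF R(1)] ij by simp
      then have "R e i j = 0" using True R(2,3) ij by auto
      moreover have "w e' (path_vertex l e (Suc i)) = 0 \<or> w e' (path_vertex l e (Suc j)) = 0" for e'
        using True l by (auto simp: path_vertex_simps w_def)
      then have "S (path_vertex l e (Suc i)) (path_vertex l e (Suc j)) = 0"
        unfolding S_def by (intro sum.neutral ballI) auto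
      ultimately show ?thesis by simp
    next
      case False
      then have "S (path_vertex l e (Suc i)) (path_vertex l e (Suc j))
          = (\<Sum>e'\<in>edges G. if e' = e then R e' i j else 0)"
        unfolding S_def using ij by (intro sum.cong refl) (simp add: path_vertex_simps w_def f_def)
      then show ?thesis using finE e by simp
    qed
    ultimately show ?thesis by simp
  qed
  from that[OF psd Orig path] show ?thesis .
qed

text \<open>\<open>F\<close> holds the edges whose ends are not made orthogonal. As
  \<open>3 \<le> l\<close> is demanded only off \<open>F\<close>, taking all edges for
  \<open>F\<close> covers \<open>l = 2\<close>.\<close>

lemma lengthen_completable:
  fixes G :: "'a ugraph"
  assumes G: "is_graph G" "verts G \<noteq> {}" and l: "2 \<le> l"
    and X: "X \<in> edge_psd (lengthen l G)" and \<epsilon>: "0 < \<epsilon>" and F: "F \<subseteq> edges G"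
    and good: "\<And>e. e \<in> edges G - F \<Longrightarrow> 3 \<le> l \<and>
      (1 / cos (pi / real l) - 1) / real l * (\<Sum>i\<in>{2..l}. X (New e i) (New e i)) \<le> \<epsilon>"
    and bad: "card F \<le> 1 \<or> eps_minus G * (\<Sum>v\<in>verts G. X (Orig v) (Orig v)) < \<epsilon>"
  shows "shifted (lengthen l G) X \<epsilon> \<in> psd_completable (lengthen l G)"
proof -
  let ?W = "verts (lengthen l G)"
  have finV: "finite (verts G)" and finF: "finite F"
    using G is_graph_finite_edges finite_subset[OF F] by (auto simp: is_graph_def)
  have symX: "X x y = X y x" for x y using X by (auto simp: edge_psd_def partial_mats_def)
  have X_Orig: "0 \<le> X (Orig v) (Orig v)" if "v \<in> verts G" for v
    using edge_psd_diag[OF X] that by (simp add: verts_lengthen)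
  define a where "a e k = X (path_vertex l e (Suc k)) (path_vertex l e (Suc k))" for e k
  define b where "b e k = X (path_vertex l e (Suc k)) (path_vertex l e (Suc (Suc k)))" for e k
  have a: "0 \<le> a e k" if "e \<in> edges G" "k \<le> l" for e k
    unfolding a_def using edge_psd_diag[OF X path_vertex_in_verts[OF G(1)]] that l by simp
  have b: "(b e k)\<^sup>2 \<le> a e k * a e (Suc k)" if "e \<in> edges G" "k < l" for e k
    unfolding a_def b_def
    using adj_path_vertex[OF G(1) that] X path_vertex_Suc_neq[OF G(1) that]
    by (intro psd_on_pair_det) (auto simp: edge_psd_def)
  have a0: "a e 0 = X (Orig (edge_src e)) (Orig (edge_src e))"
    and al: "a e l = X (Orig (edge_tgt e)) (Orig (edge_tgt e))" for e
    using l by (simp_all add: a_def path_vertex_simps)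
  have "\<exists>P. psd_on {..l} P \<and> (\<forall>k\<le>l. P k k = a e k) \<and> (\<forall>k<l. P k (Suc k) = b e k)"
    if "e \<in> edges G" for e
    by (rule psd_path_completion[of l "a e" "b e"]) (use a b that in auto)
  then obtain Q where Q: "\<And>e. e \<in> edges G \<Longrightarrow> psd_on {..l} (Q e)"
      "\<And>e k. e \<in> edges G \<Longrightarrow> k \<le> l \<Longrightarrow> Q e k k = a e k"
      "\<And>e k. e \<in> edges G \<Longrightarrow> k < l \<Longrightarrow> Q e k (Suc k) = b e k"
    by metis
  have "\<exists>P. psd_on {..l} P \<and> (\<forall>k\<le>l. P k k = a e k + \<epsilon>) \<and> (\<forall>k<l. P k (Suc k) = b e k) \<and> P 0 l = 0"
    if e: "e \<in> edges G - F" for e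
  proof -
    have "(\<Sum>k\<in>{1..<l}. a e k) = (\<Sum>k\<in>{1..<l}. X (New e (Suc k)) (New e (Suc k)))"
      by (intro sum.cong refl) (simp add: a_def path_vertex_simps)
    also have "\<dots> = (\<Sum>i\<in>{Suc 1..<Suc l}. X (New e i) (New e i))"
      by (rule sum.shift_bounds_Suc_ivl[symmetric])
    also have "{Suc 1..<Suc l} = {2..l}" by auto
    finally have tr: "(1 / cos (pi / real l) - 1) / real l * (\<Sum>k\<in>{1..<l}. a e k) \<le> \<epsilon>"
      and l3: "3 \<le> l" using good[OF e] by simp_all
    show ?thesis
      by (rule psd_path_completion_orthogonal_ends[OF l3 _ \<epsilon> _ tr, where b = "b e"]) (use a b e in auto)
  qed
  then obtain R where R: "\<And>e. e \<in> edges G - F \<Longrightarrow> psd_on {..l} (R e)"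
      "\<And>e k. e \<in> edges G - F \<Longrightarrow> k \<le> l \<Longrightarrow> R e k k = a e k + \<epsilon>"
      "\<And>e k. e \<in> edges G - F \<Longrightarrow> k < l \<Longrightarrow> R e k (Suc k) = b e k"
      "\<And>e. e \<in> edges G - F \<Longrightarrow> R e 0 l = 0"
    by metis
  define P where "P e i j = (if e \<in> F then Q e i j + (if i = j then \<epsilon> else 0) else R e i j)" for e i j
  have P: "psd_on {..l} (P e)" if "e \<in> edges G" for e
    unfolding P_def using Q(1) R(1) that \<epsilon> by (cases "e \<in> F") (auto intro!: psd_on_add psd_on_diag)
  have P_diag: "P e k k = a e k + \<epsilon>" if "e \<in> edges G" "k \<le> l" for e k
    using Q(2) R(2) that by (simp add: P_def)
  have P_next: "P e k (Suc k) = b e k" if "e \<in> edges G" "k < l" for e k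
    using Q(3) R(3) that by (simp add: P_def)
  \<comment> \<open>On \<open>F\<close> the closing value comes from the unshifted completion
    \<open>Q\<close>, so it is compatible with the unshifted end entries. Thus \<open>Y\<close> lies
    in \<open>edge_psd G\<close>, and one and the same \<epsilon> serves on \<open>G\<close> and on
    the paths.\<close>
  define c where "c e = (if e \<in> F then Q e 0 l else 0)" for e
  have P_ends: "P e 0 l = c e" if "e \<in> edges G" for e
    using R(4) that l by (simp add: P_def c_def)
  have c: "(c e)\<^sup>2 \<le> a e 0 * a e l" if "e \<in> edges G" for e
  proof -
    have "psd_on {0, l} (Q e)" using Q(1)[OF that] by (rule psd_on_subset) auto
    from psd_on_pair_det[OF this] show ?thesis
      using l a[OF that, of 0] a[OF that, of l] Q(2)[OF that, of 0] Q(2)[OF that, of l]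
      by (simp add: c_def)
  qed
  define Y where "Y u v = (if u = v then if v \<in> verts G then X (Orig v) (Orig v) else 0
    else if {u, v} \<in> edges G then c {u, v} else 0)" for u v
  have Y: "Y \<in> edge_psd G"
  proof -
    have sym: "Y u v = Y v u" for u v by (auto simp: Y_def insert_commute)
    have "psd_on {u, v} Y" if uv: "adj G u v" for u v
    proof (cases "u = v")
      case True
      then show ?thesis using uv X_Orig by (auto intro!: psd_on_singletonI simp: Y_def adj_def)
    next
      case False
      define e where "e = {u, v}"
      have e: "e \<in> edges G" using uv False by (simp add: adj_def e_def)
      have "a e 0 * a e l = X (Orig u) (Orig u) * X (Orig v) (Orig v)"
        using is_graph_edge(4)[OF G(1) e] by (auto simp: a0 al e_def doubleton_eq_iff)
      then have "(Y u v)\<^sup>2 \<le> Y u u * Y v v"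
        using c[OF e] e uv False by (simp add: Y_def e_def adj_def)
      moreover have "0 \<le> Y w w" for w using X_Orig by (simp add: Y_def)
      ultimately show ?thesis using False sym by (intro psd_on_pairI)
    qed
    moreover have "Y u v = 0" if "\<not> adj G u v" for u v
    proof -
      have "{u, v} \<in> edges G \<Longrightarrow> u \<in> verts G \<and> v \<in> verts G"
        using G(1) by (auto simp: is_graph_def)
      then show ?thesis using that by (auto simp: Y_def adj_def)
    qed
    ultimately show ?thesis using sym by (simp add: edge_psd_def partial_mats_def)
  qed
  have Y_trace: "ptrace G Y = (\<Sum>v\<in>verts G. X (Orig v) (Orig v))"
    by (simp add: ptrace_def Y_def)
  have "shifted G Y \<epsilon> \<in> psd_completable G"
  proof (cases "card F \<le> 1")
    case False
    then show ?thesis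
      using shifted_completable_if_eps_minus_less[OF finV G(2) Y _ \<epsilon>] bad Y_trace by simp
  next
    case True
    \<comment> \<open>\<open>T\<close> is the exceptional edge itself, read as a vertex set, or
      empty if there is none.\<close>
    have "\<exists>T. F \<subseteq> {T} \<and> T \<subseteq> verts G \<and> psd_on T Y"
    proof (cases "F = {}")
      case False
      then obtain e where e: "F = {e}" using True finF by (metis card_1_singletonE card_0_eq le_neq_implies_less less_one)
      then have eG: "e \<in> edges G" using F by auto
      note st = is_graph_edge[OF G(1) eG]
      have "psd_on {edge_src e, edge_tgt e} Y" using Y st(5) by (simp add: edge_psd_def)
      then have "psd_on e Y" by (simp flip: st(4))
      moreover have "e \<subseteq> verts G" using G(1) eG by (simp add: is_graph_def)
      ultimately show ?thesis using e by blast
    next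
      case True
      then show ?thesis by (intro exI[of _ "{}"]) (simp add: psd_on_def)
    qed
    then obtain T where T: "F \<subseteq> {T}" "T \<subseteq> verts G" "psd_on T Y" by blast
    have "psd_on (verts G) Y"
    proof (rule psd_on_single_edge[OF finV _ T(3,2)])
      show "0 \<le> Y v v" if "v \<in> verts G" for v using edge_psd_diag[OF Y that] .
      show "Y u v = 0" if "u \<noteq> v" "\<not> {u, v} \<subseteq> T" for u v
        using that T(1) by (auto simp: Y_def c_def)
    qed
    then have "shifted G Y 0 \<in> psd_completable G"
      unfolding shifted_completable_iff[OF edge_psd_partial[OF Y]] by auto
    from shifted_completable_mono[OF finV edge_psd_partial[OF Y] this less_imp_le[OF \<epsilon>]]
    show ?thesis .
  qed
  then obtain MG where MG: "psd_on (verts G) MG"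
      "\<And>u v. adj G u v \<Longrightarrow> MG u v = Y u v + \<epsilon> * id_partial G u v"
    unfolding shifted_completable_iff[OF edge_psd_partial[OF Y]] by blast
  have MG_diag: "MG v v = X (Orig v) (Orig v) + \<epsilon>" if "v \<in> verts G" for v
    using MG(2)[OF adj_refl[OF that]] that by (simp add: Y_def id_partial_def)
  have MG_edge: "MG (edge_src e) (edge_tgt e) = c e" if e: "e \<in> edges G" for e
    using MG(2)[OF is_graph_edge(5)[OF G(1) e]] is_graph_edge[OF G(1) e] e
    by (simp add: Y_def id_partial_def)
  \<comment> \<open>Here \<epsilon> > 0 is essential: it makes the weak inequality for the ends
    strict, as the Schur complement requires.\<close>
  have det: "P e 0 0 * P e l l \<noteq> (P e 0 l)\<^sup>2" if e: "e \<in> edges G" for e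
  proof -
    have "(c e)\<^sup>2 \<le> a e 0 * a e l" using c[OF e] .
    also have "\<dots> < (a e 0 + \<epsilon>) * (a e l + \<epsilon>)"
      using a[OF e, of 0] a[OF e, of l] \<epsilon> by (intro mult_strict_mono') auto
    finally show ?thesis using P_diag[OF e, of 0] P_diag[OF e, of l] P_ends[OF e] by simp
  qed
  have l0: "0 < l" using l by simp
  obtain M where M: "psd_on ?W M"
    "\<And>u v. u \<in> verts G \<Longrightarrow> v \<in> verts G \<Longrightarrow> M (Orig u) (Orig v) = MG u v"
    "\<And>e i j. e \<in> edges G \<Longrightarrow> i \<le> l \<Longrightarrow> j \<le> l \<Longrightarrow>
      M (path_vertex l e (Suc i)) (path_vertex l e (Suc j)) = P e i j"
  proof (rule glue_path_completions[OF G(1) l0 MG(1) P])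
    show "P e 0 0 = MG (edge_src e) (edge_src e)" "P e l l = MG (edge_tgt e) (edge_tgt e)"
      "P e 0 l = MG (edge_src e) (edge_tgt e)" if e: "e \<in> edges G" for e
      using is_graph_edge[OF G(1) e] P_diag[OF e] P_ends[OF e] MG_diag MG_edge[OF e] a0 al by auto
  qed (use det in auto)
  have "M x y = X x y + \<epsilon> * id_partial (lengthen l G) x y" if adj: "adj (lengthen l G) x y" for x y
    using adj
  proof (cases rule: adj_lengthenE)
    case (1 v)
    then show ?thesis using M(2) MG_diag by (simp add: id_partial_def verts_lengthen)
  next
    case (2 e k)
    then have "x \<in> ?W" "path_vertex l e (Suc k) = New e (Suc k)"
      by (auto simp: verts_lengthen path_vertex_simps)
    then show ?thesis using 2 M(3)[of e k k] P_diag[of e k] by (simp add: id_partial_def a_def)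
  next
    case (3 e k)
    define x' where "x' = path_vertex l e (Suc k)"
    define y' where "y' = path_vertex l e (Suc (Suc k))"
    have eq: "M x' y' = X x' y'"
      using M(3)[of e k "Suc k"] P_next[of e k] 3 by (simp add: x'_def y'_def b_def)
    have W: "x' \<in> ?W" "y' \<in> ?W"
      using path_vertex_in_verts[OF G(1) 3(1)] 3(2) l0 by (auto simp: x'_def y'_def)
    have neq: "x' \<noteq> y'" using path_vertex_Suc_neq[OF G(1) 3(1,2)] by (simp add: x'_def y'_def)
    have "x = x' \<and> y = y' \<or> x = y' \<and> y = x'"
      using 3(3) by (auto simp: x'_def y'_def doubleton_eq_iff)
    then show ?thesis
      using eq neq psd_on_sym[OF M(1) W] symX[of x' y'] by (auto simp: id_partial_def)
  qed
  then show ?thesis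
    unfolding shifted_completable_iff[OF edge_psd_partial[OF X]] using M(1) by blast
qed

section \<open>Charging the trace and the final estimate\<close>

lemma verts_lengthen_singleton:
  assumes "is_graph G" "verts G = {v}"
  shows "verts (lengthen l G) = {Orig v}"
proof -
  have "e \<notin> edges G" for e
    using is_graph_edge(1-3)[OF assms(1), of e] assms(2) by auto
  then have "edges G = {}" by blast
  then show ?thesis by (simp add: verts_lengthen assms(2))
qed

lemma sec_cycle_pos:
  assumes "3 \<le> l"
  shows "0 < (1 / cos (pi / real l) - 1) / real l"
proof -
  have "pi / real l < pi / 2" using assms by (intro divide_strict_left_mono) auto
  then have "0 < cos (pi / real l)" "cos (pi / real l) < 1"
    using assms cos_gt_zero[of "pi / real l"] cos_monotone_0_pi[of 0 "pi / real l"]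
    by (auto simp: field_simps)
  then show ?thesis using assms by simp
qed

text \<open>Leaving \<open>c\<close> free above the explicit constant lets one proof serve
  \<open>eps\<close> and \<open>eps_minus\<close> of the cycle. The paths are tested with the
  constant, the trace count ends with \<open>c\<close>.\<close>

lemma eps_lengthen_le:
  assumes G: "is_graph G" "verts G \<noteq> {}" and l: "3 \<le> l"
    and c: "(1 / cos (pi / real l) - 1) / real l \<le> c" "c \<le> 1"
  shows "eps (lengthen l G) \<le> c * eps_minus G / (c + 2 * eps_minus G)"
proof (cases "\<exists>v. verts G = {v}")
  case True
  then obtain v where v: "verts G = {v}" by blast
  have "eps (lengthen l G) \<le> -1" by (rule singleton_eps[OF verts_lengthen_singleton[OF G(1) v]])
  \<comment> \<open>With \<open>eps_minus G = -1\<close> the right side is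
    \<open>(- c) / (c - 2)\<close>, which is nonnegative.\<close>
  also have "\<dots> \<le> c * eps_minus G / (c + 2 * eps_minus G)"
  proof -
    have "0 \<le> c" using sec_cycle_pos[OF l] c by linarith
    then have "0 \<le> (- c) / (c - 2)" using c(2) by (intro divide_nonpos_nonpos) auto
    then show ?thesis by (simp add: singleton_eps(2)[OF v])
  qed
  finally show ?thesis .
next
  case False
  define \<eta> where "\<eta> = eps_minus G"
  define c\<^sub>0 where "c\<^sub>0 = (1 / cos (pi / real l) - 1) / real l"
  have finV: "finite (verts G)" using G by (simp add: is_graph_def)
  have finE: "finite (edges G)" by (rule is_graph_finite_edges[OF G(1)])
  obtain v w where "v \<in> verts G" "w \<in> verts G" "v \<noteq> w" using False G(2) by blast
  then have \<eta>: "0 \<le> \<eta>" unfolding \<eta>_def using eps_minus_nonneg[OF finV] by blast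
  have c0: "0 < c\<^sub>0" "c\<^sub>0 \<le> c" "0 < c" using sec_cycle_pos[OF l] c by (auto simp: c\<^sub>0_def)
  show ?thesis unfolding \<eta>_def[symmetric]
  proof (rule eps_le)
    show "finite (verts (lengthen l G))" using G(1) by (rule finite_verts_lengthen)
    show "verts (lengthen l G) \<noteq> {}" using G(2) by (simp add: verts_lengthen)
    fix X \<epsilon>
    assume X: "X \<in> clique_psd (lengthen l G)" "ptrace (lengthen l G) X = 1"
      and less: "c * \<eta> / (c + 2 * \<eta>) < \<epsilon>"
    have X': "X \<in> edge_psd (lengthen l G)" using X clique_psd_subset_edge_psd by blast
    have "0 \<le> c * \<eta> / (c + 2 * \<eta>)" using c0 \<eta> by simp
    with less have \<epsilon>: "0 < \<epsilon>" by linarith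
    define t where "t e = (\<Sum>i\<in>{2..l}. X (New e i) (New e i))" for e
    define t\<^sub>0 where "t\<^sub>0 = (\<Sum>v\<in>verts G. X (Orig v) (Orig v))"
    have t: "0 \<le> t e" if "e \<in> edges G" for e
      unfolding t_def using that by (intro sum_nonneg edge_psd_diag[OF X']) (auto simp: verts_lengthen)
    have sum1: "t\<^sub>0 + (\<Sum>e\<in>edges G. t e) = 1"
      using ptrace_lengthen[OF G(1)] X(2) by (simp add: t_def t\<^sub>0_def)
    define F where "F = {e \<in> edges G. \<epsilon> < c\<^sub>0 * t e}"
    show "shifted (lengthen l G) X \<epsilon> \<in> psd_completable (lengthen l G)"
    proof (rule lengthen_completable[OF G _ X' \<epsilon>, of F])
      show "card F \<le> 1 \<or> eps_minus G * (\<Sum>v\<in>verts G. X (Orig v) (Orig v)) < \<epsilon>"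
        unfolding t\<^sub>0_def[symmetric] \<eta>_def[symmetric]
      proof (rule disjCI)
        assume "\<not> \<eta> * t\<^sub>0 < \<epsilon>"
        then have ge: "\<epsilon> \<le> \<eta> * t\<^sub>0" by simp
        show "card F \<le> 1"
        proof (rule ccontr)
          assume "\<not> card F \<le> 1"
          then have "2 * \<epsilon> \<le> real (card F) * \<epsilon>" using \<epsilon> by (intro mult_right_mono) auto
          also have "\<dots> = (\<Sum>e\<in>F. \<epsilon>)" by simp
          also have "\<dots> \<le> (\<Sum>e\<in>F. c\<^sub>0 * t e)" by (intro sum_mono) (auto simp: F_def)
          also have "\<dots> \<le> (\<Sum>e\<in>edges G. c\<^sub>0 * t e)"
            using finE t c0 by (intro sum_mono2) (auto simp: F_def)
          also have "\<dots> = c\<^sub>0 * (1 - t\<^sub>0)" using sum1 by (simp flip: sum_distrib_left)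
          also have "\<dots> \<le> c * (1 - t\<^sub>0)"
            using c0 sum_nonneg[of "edges G" t] t sum1 by (intro mult_right_mono) auto
          \<comment> \<open>Adding this to the next inequality eliminates \<open>t\<^sub>0\<close>
            and gives \<open>\<epsilon> * (c + 2 * \<eta>) \<le> c * \<eta>\<close>, against the
            choice of \<epsilon>.\<close>
          finally have "\<eta> * (2 * \<epsilon>) \<le> \<eta> * (c * (1 - t\<^sub>0))" using \<eta> by (rule mult_left_mono)
          moreover have "c * \<epsilon> \<le> c * (\<eta> * t\<^sub>0)" using ge c0 by (intro mult_left_mono) auto
          moreover have "c * \<eta> < \<epsilon> * (c + 2 * \<eta>)"
            using less c0 \<eta> by (simp add: pos_divide_less_eq)
          ultimately show False by (simp add: algebra_simps)
        qed
      qed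
    qed (use l in \<open>auto simp: F_def t_def c\<^sub>0_def not_less\<close>)
  qed
qed

text \<open>The limit of the general bound for \<open>c\<close> tending to infinity, in line with
  \<open>cos (pi / 2) = 0\<close>. All edges are exceptional, and the original vertices carry trace
  at most 1.\<close>

lemma eps_subdivision_le:
  assumes G: "is_graph G" "verts G \<noteq> {}"
  shows "eps (lengthen 2 G) \<le> eps_minus G"
proof (cases "\<exists>v. verts G = {v}")
  case True
  then obtain v where v: "verts G = {v}" by blast
  have "eps (lengthen 2 G) \<le> -1" by (rule singleton_eps[OF verts_lengthen_singleton[OF G(1) v]])
  then show ?thesis by (simp add: singleton_eps(2)[OF v])
next
  case False
  have finV: "finite (verts G)" using G by (simp add: is_graph_def)
  obtain v w where "v \<in> verts G" "w \<in> verts G" "v \<noteq> w" using False G(2) by blast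
  then have \<eta>: "0 \<le> eps_minus G" using eps_minus_nonneg[OF finV] by blast
  show ?thesis
  proof (rule eps_le)
    show "finite (verts (lengthen 2 G))" using G(1) by (rule finite_verts_lengthen)
    show "verts (lengthen 2 G) \<noteq> {}" using G(2) by (simp add: verts_lengthen)
    fix X \<epsilon>
    assume X: "X \<in> clique_psd (lengthen 2 G)" "ptrace (lengthen 2 G) X = 1"
      and less: "eps_minus G < \<epsilon>"
    have X': "X \<in> edge_psd (lengthen 2 G)" using X clique_psd_subset_edge_psd by blast
    have "0 \<le> (\<Sum>e\<in>edges G. \<Sum>i\<in>{2..2}. X (New e i) (New e i))"
      by (intro sum_nonneg edge_psd_diag[OF X']) (auto simp: verts_lengthen)
    then have "(\<Sum>v\<in>verts G. X (Orig v) (Orig v)) \<le> 1"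
      using ptrace_lengthen[OF G(1), of 2 X] X(2) by simp
    then have "eps_minus G * (\<Sum>v\<in>verts G. X (Orig v) (Orig v)) \<le> eps_minus G"
      using mult_left_mono[OF _ \<eta>] by fastforce
    with less \<eta> show "shifted (lengthen 2 G) X \<epsilon> \<in> psd_completable (lengthen 2 G)"
      by (intro lengthen_completable[OF G _ X', of _ "edges G"]) auto
  qed
qed

text \<open>For \<open>l = 3\<close> the clique value of the triangle is 0 and would give the bound
  0, which fails when \<open>G\<close> is a triangle, since its lengthening is a nine-cycle;
  \<open>eps_minus\<close> is the value continuing the pattern. For \<open>l = 2\<close> there is no
  cycle, and the limiting bound takes its place.\<close>

theorem theorem3p4:
  fixes G :: "'a ugraph" and l :: nat
  assumes "is_graph G" and "verts G \<noteq> {}" and "l > 1"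
  shows "(l \<ge> 4 \<longrightarrow>
            eps (lengthen l G)
              \<le> eps (cycle_graph l) * eps_minus G / (eps (cycle_graph l) + 2 * eps_minus G))
       \<and> (l = 3 \<longrightarrow>
            eps (lengthen l G)
              \<le> eps_minus (cycle_graph l) * eps_minus G
                  / (eps_minus (cycle_graph l) + 2 * eps_minus G))
       \<and> (l = 2 \<longrightarrow> eps (lengthen l G) \<le> eps_minus G)"
proof (intro conjI impI)
  show "eps (lengthen l G) \<le> eps (cycle_graph l) * eps_minus G / (eps (cycle_graph l) + 2 * eps_minus G)"
    if "l \<ge> 4"
    using that by (intro eps_lengthen_le assms cycle_eps_bounds) auto
  show "eps (lengthen l G) \<le> eps_minus (cycle_graph l) * eps_minus G
      / (eps_minus (cycle_graph l) + 2 * eps_minus G)" if "l = 3"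
    using that by (intro eps_lengthen_le assms cycle_eps_minus_bounds) auto
  show "eps (lengthen l G) \<le> eps_minus G" if "l = 2"
    using eps_subdivision_le[OF assms(1,2)] that by simp
qed

end
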